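(* Let $E\to M$ be a vector bundle with a Lie algebroid structure, let $\Phi\in A^1(E^* )$ be a $1$-cocycle ($\mathrm d\Phi=0$), let $\hat E=E\times\mathbb R$ over $M\times\mathbb R$ be the associated extended Lie algebroid with Schouten bracket $[\![\cdot,\cdot]\!]\hat{}$, and let $\tilde U:A(E)\to A(\hat E)$ be the linear map given on homogeneous elements by $\tilde U(X)=e^{-xt}U(X)$, $x=|X|-1$. Then for any homogeneous elements $X,Y\in A(E)$, with $x=|X|-1$ and $y=|Y|-1$, $$[\![\tilde U(X),\tilde U(Y)]\!]\hat{}=\tilde U\big([\![X,Y]\!]+x\,X\wedge i_\Phi Y-(-1)^x y\,i_\Phi X\wedge Y\big)=\tilde U([\![X,Y]\!]^\Phi).$$
   Context: All objects are smooth. $A(E)=\bigoplus_k A^k(E)$, $A^k(E)=\mathrm{Sec}(\bigwedge^kE)$, $A^0(E)=C^\infty(M)$; $|X|$ is the Grassmann degree of $X$ and $x=|X|-1$ (similarly $y$ for $Y$, etc.). For a Lie algebroid structure on $E$ with anchor $\rho$, $\mathrm d$ is the Lie algebroid exterior derivative on $A(E^* )$ and $[\![\cdot,\cdot]\!]$ is the Schouten bracket on $A(E)$: the unique bracket of degree $-1$ extending the Lie algebroid bracket on sections, with $[\![X,f]\!]=\rho(X)(f)$ for sections $X$ and functions $f$, $[\![X,Y]\!]=-(-1)^{xy}[\![Y,X]\!]$, and $[\![X,Y\wedge Z]\!]=[\![X,Y]\!]\wedge Z+(-1)^{x(y+1)}Y\wedge[\![X,Z]\!]$. For $\Phi\in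 A^1(E^* )$, $i_\Phi$ is the graded derivation of degree $-1$ of $A(E)$ with $i_\Phi X=\langle\Phi,X\rangle$ for sections $X$ and $i_\Phi f=0$ for functions. The Schouten-Jacobi bracket is $[\![X,Y]\!]^\Phi=[\![X,Y]\!]+x\,X\wedge i_\Phi Y-(-1)^x y\,i_\Phi X\wedge Y$. Extended Lie algebroid: $\hat E=E\times\mathbb R$ is the pulled-back bundle over $M\times\mathbb R$, whose sections are time-dependent sections of $E$; $t$ is the coordinate on $\mathbb R$. $U:A(E)\to A(\hat E)$ is the embedding onto time-independent multisections. The Lie algebroid structure on $\hat E$ is the unique one for which the bracket of time-independent sections is that of $E$ (i.e. $[U(X),U(Y)]=U([X,Y])$) and the anchor on time-independent sections is $\hat\rho(X)=\rho(X)+\langle\Phi,X\rangle\partial_t$; for its exterior derivative one has $\mathrm dt=\Phi$. *)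

theory Defs
  imports "HOL-Analysis.Analysis" "HOL-Computational_Algebra.Formal_Power_Series"
begin

section \<open>The exterior algebra of a real vector space\<close>

text \<open>
  The exterior algebra over the type \<open>'v\<close> is given by its presentation: the associative unital
  real algebra generated by the vectors of \<open>'v\<close>, subject to linearity of the inclusion of
  generators and to \<open>v \<and> v = 0\<close>.  Scalars are embedded by \<open>Scal\<close>, and scalar multiplication is
  multiplication by a (central) scalar.
\<close>

datatype 'v ext_term =
    Gen 'v
  | Scal real
  | Add "'v ext_term" "'v ext_term"
  | Mul "'v ext_term" "'v ext_term"

inductive ext_eq :: "'v::real_vector ext_term \<Rightarrow> 'v ext_term \<Rightarrow> bool" where
  refl: "ext_eq a a"
| sym: "ext_eq a b \<Longrightarrow> ext_eq b a"
| trans: "ext_eq a b \<Longrightarrow> ext_eq b c \<Longrightarrow> ext_eq a c"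
| add_cong: "ext_eq a b \<Longrightarrow> ext_eq c d \<Longrightarrow> ext_eq (Add a c) (Add b d)"
| mul_cong: "ext_eq a b \<Longrightarrow> ext_eq c d \<Longrightarrow> ext_eq (Mul a c) (Mul b d)"
| add_assoc: "ext_eq (Add (Add a b) c) (Add a (Add b c))"
| add_comm: "ext_eq (Add a b) (Add b a)"
| add_zero: "ext_eq (Add (Scal 0) a) a"
| add_neg: "ext_eq (Add (Mul (Scal (- 1)) a) a) (Scal 0)"
| mul_assoc: "ext_eq (Mul (Mul a b) c) (Mul a (Mul b c))"
| mul_one: "ext_eq (Mul (Scal 1) a) a"
| distrib_right: "ext_eq (Mul (Add a b) c) (Add (Mul a c) (Mul b c))"
| distrib_left: "ext_eq (Mul a (Add b c)) (Add (Mul a b) (Mul a c))"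
| scal_central: "ext_eq (Mul (Scal r) a) (Mul a (Scal r))"
| scal_add: "ext_eq (Scal (r + s)) (Add (Scal r) (Scal s))"
| scal_mul: "ext_eq (Scal (r * s)) (Mul (Scal r) (Scal s))"
| gen_add: "ext_eq (Gen (v + w)) (Add (Gen v) (Gen w))"
| gen_scale: "ext_eq (Gen (r *\<^sub>R v)) (Mul (Scal r) (Gen v))"
| gen_square: "ext_eq (Mul (Gen v) (Gen v)) (Scal 0)"

lemma equivp_ext_eq: "equivp ext_eq"
proof (rule equivpI)
  show "reflp ext_eq" by (rule reflpI) (rule ext_eq.refl)
  show "symp ext_eq" by (rule sympI) (rule ext_eq.sym)
  show "transp ext_eq" by (rule transpI) (rule ext_eq.trans)
qed

quotient_type (overloaded) 'v ext = "'v::real_vector ext_term" / ext_eq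
  by (rule equivp_ext_eq)

text \<open>The constant term of an element, used to see that the algebra is not trivial.\<close>

primrec const_term :: "'v ext_term \<Rightarrow> real" where
  "const_term (Gen v) = 0"
| "const_term (Scal r) = r"
| "const_term (Add a b) = const_term a + const_term b"
| "const_term (Mul a b) = const_term a * const_term b"

lemma const_term_cong: "ext_eq a b \<Longrightarrow> const_term a = const_term b"
  by (induction rule: ext_eq.induct) (auto simp: algebra_simps)

instantiation ext :: (real_vector) real_algebra_1
begin

lift_definition zero_ext :: "'a ext" is "Scal 0" .
lift_definition one_ext :: "'a ext" is "Scal 1" .
lift_definition plus_ext :: "'a ext \<Rightarrow> 'a ext \<Rightarrow> 'a ext" is Add
  by (rule ext_eq.add_cong)
lift_definition times_ext :: "'a ext \<Rightarrow> 'a ext \<Rightarrow> 'a ext" is Mul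
  by (rule ext_eq.mul_cong)
lift_definition uminus_ext :: "'a ext \<Rightarrow> 'a ext" is "Mul (Scal (- 1))"
  by (rule ext_eq.mul_cong[OF ext_eq.refl])
lift_definition minus_ext :: "'a ext \<Rightarrow> 'a ext \<Rightarrow> 'a ext" is "\<lambda>a b. Add a (Mul (Scal (- 1)) b)"
  by (intro ext_eq.add_cong ext_eq.mul_cong ext_eq.refl)
lift_definition scaleR_ext :: "real \<Rightarrow> 'a ext \<Rightarrow> 'a ext" is "\<lambda>r. Mul (Scal r)"
  by (rule ext_eq.mul_cong[OF ext_eq.refl])

instance
proof
  fix a b c :: "'a ext" and r s :: real
  show "a + b + c = a + (b + c)" by transfer (rule ext_eq.add_assoc)
  show "a + b = b + a" by transfer (rule ext_eq.add_comm)
  show "0 + a = a" by transfer (rule ext_eq.add_zero)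
  show "- a + a = 0" by transfer (rule ext_eq.add_neg)
  show "a - b = a + - b" by transfer (rule ext_eq.refl)
  show "a * b * c = a * (b * c)" by transfer (rule ext_eq.mul_assoc)
  show "1 * a = a" by transfer (rule ext_eq.mul_one)
  show "a * 1 = a"
    by transfer (rule ext_eq.trans[OF ext_eq.sym[OF ext_eq.scal_central] ext_eq.mul_one])
  show "(a + b) * c = a * c + b * c" by transfer (rule ext_eq.distrib_right)
  show "a * (b + c) = a * b + a * c" by transfer (rule ext_eq.distrib_left)
  show "(0 :: 'a ext) \<noteq> 1" by transfer (auto dest: const_term_cong)
  show "r *\<^sub>R (a + b) = r *\<^sub>R a + r *\<^sub>R b" by transfer (rule ext_eq.distrib_left)
  show "(r + s) *\<^sub>R a = r *\<^sub>R a + s *\<^sub>R a"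
    by transfer
      (rule ext_eq.trans[OF ext_eq.mul_cong[OF ext_eq.scal_add ext_eq.refl] ext_eq.distrib_right])
  show "r *\<^sub>R s *\<^sub>R a = (r * s) *\<^sub>R a"
    by transfer
      (rule ext_eq.trans[OF ext_eq.sym[OF ext_eq.mul_assoc]
          ext_eq.mul_cong[OF ext_eq.sym[OF ext_eq.scal_mul] ext_eq.refl]])
  show "1 *\<^sub>R a = a" by transfer (rule ext_eq.mul_one)
  show "r *\<^sub>R a * b = r *\<^sub>R (a * b)" by transfer (rule ext_eq.mul_assoc)
  show "a * r *\<^sub>R b = r *\<^sub>R (a * b)"
    by transfer
      (rule ext_eq.trans[OF ext_eq.sym[OF ext_eq.mul_assoc]
          ext_eq.trans[OF ext_eq.mul_cong[OF ext_eq.sym[OF ext_eq.scal_central] ext_eq.refl]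
            ext_eq.mul_assoc]])
qed

end

text \<open>The inclusion of vectors; the product of the algebra \<open>'v ext\<close> is the wedge product.\<close>

lift_definition gen :: "'v::real_vector \<Rightarrow> 'v ext" is Gen .

lemma gen_add: "gen (v + w) = gen v + gen w"
  by transfer (rule ext_eq.gen_add)

lemma gen_scaleR: "gen (r *\<^sub>R v) = r *\<^sub>R gen v"
  by transfer (rule ext_eq.gen_scale)

lemma gen_square: "gen v * gen v = 0"
  by transfer (rule ext_eq.gen_square)

text \<open>
  The grading: the algebra homomorphism to power series over \<open>'v ext\<close> which sends \<open>v\<close> to \<open>v X\<close>
  has the homogeneous components as its coefficients.
\<close>

primrec grading :: "'v::real_vector ext_term \<Rightarrow> 'v ext fps" where
  "grading (Gen v) = fps_const (gen v) * fps_X"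
| "grading (Scal r) = fps_const (of_real r)"
| "grading (Add a b) = grading a + grading b"
| "grading (Mul a b) = grading a * grading b"

lemma grading_cong: "ext_eq a b \<Longrightarrow> grading a = grading b"
proof (induction rule: ext_eq.induct)
  case (add_neg a)
  show ?case by (rule fps_ext) simp
next
  case (scal_central r a)
  show ?case by (rule fps_ext) (simp add: of_real_def)
next
  case (gen_add v w)
  show ?case by (rule fps_ext) (simp add: Defs.gen_add)
next
  case (gen_scale r v)
  show ?case by (rule fps_ext) (simp add: gen_scaleR of_real_def)
next
  case (gen_square v)
  have "fps_const (gen v) * fps_X * (fps_const (gen v) * fps_X)
      = fps_const (gen v) * (fps_X * fps_const (gen v)) * fps_X"
    by (simp only: mult.assoc)
  also have "\<dots> = fps_const (gen v) * (fps_const (gen v) * fps_X) * fps_X"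
    by (simp only: fps_mult_fps_X_commute)
  also have "\<dots> = fps_const (gen v * gen v) * (fps_X * fps_X)"
    by (simp only: mult.assoc fps_const_mult[symmetric])
  finally show ?case by (simp add: Defs.gen_square)
next
  case (distrib_right a b c)
  show ?case by (simp only: grading.simps ring_distribs)
next
  case (distrib_left a b c)
  show ?case by (simp only: grading.simps ring_distribs)
qed (simp_all add: add.assoc add.commute mult.assoc)

lift_definition ext_part :: "nat \<Rightarrow> 'v::real_vector ext \<Rightarrow> 'v ext" is "\<lambda>k a. fps_nth (grading a) k"
  by (simp add: grading_cong)

lemma ext_part_gen: "ext_part k (gen v) = (if k = 1 then gen v else 0)"
proof -
  have "ext_part k (gen v) = fps_nth (grading (Gen v)) k"
    by (simp only: gen.abs_eq ext_part.abs_eq)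
  then show ?thesis by simp
qed

lemma ext_part_add: "ext_part k (a + b) = ext_part k a + ext_part k b"
  by transfer simp

lemma ext_part_mult: "ext_part k (a * b) = (\<Sum>i\<le>k. ext_part i a * ext_part (k - i) b)"
  by transfer (simp add: fps_mult_nth atMost_atLeast0)


section \<open>Smooth manifolds\<close>

text \<open>On an open subset of a finite-dimensional space these are the maps of class \<open>C\<^sup>k\<close>.\<close>

primrec Ck_on :: "nat \<Rightarrow> 'a::real_normed_vector set \<Rightarrow> ('a \<Rightarrow> 'b::real_normed_vector) \<Rightarrow> bool" where
  "Ck_on 0 S f \<longleftrightarrow> continuous_on S f"
| "Ck_on (Suc k) S f \<longleftrightarrow>
     (\<forall>x\<in>S. f differentiable (at x)) \<and> (\<forall>v. Ck_on k S (\<lambda>x. frechet_derivative f (at x) v))"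

definition smooth_on :: "'a::real_normed_vector set \<Rightarrow> ('a \<Rightarrow> 'b::real_normed_vector) \<Rightarrow> bool" where
  "smooth_on S f \<longleftrightarrow> (\<forall>k. Ck_on k S f)"

text \<open>
  A chart is a pair \<open>(U, \<phi>)\<close>.  The underlying Hausdorff second countable space is a type.  The model
  space is a finite-dimensional inner product space; the class \<open>euclidean_space\<close> is avoided because
  it has no zero-dimensional instance, while Lie algebras (Lie algebroids over a point) are to be
  covered.
\<close>

type_synonym ('m, 'e) atlas = "('m set \<times> ('m \<Rightarrow> 'e)) set"

definition smooth_manifold ::
  "('m::{t2_space, second_countable_topology}, 'e::real_inner) atlas \<Rightarrow> bool" where
  "smooth_manifold \<A> \<longleftrightarrow>
     (\<exists>B::'e set. finite B \<and> span B = UNIV) \<and>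
     (\<Union>(U, \<phi>)\<in>\<A>. U) = UNIV \<and>
     (\<forall>(U, \<phi>)\<in>\<A>. open U \<and> open (\<phi> ` U) \<and> homeomorphism U (\<phi> ` U) \<phi> (inv_into U \<phi>)) \<and>
     (\<forall>(U, \<phi>)\<in>\<A>. \<forall>(V, \<psi>)\<in>\<A>. smooth_on (\<phi> ` (U \<inter> V)) (\<psi> \<circ> inv_into U \<phi>))"

definition smooth_fun :: "('m, 'e::real_inner) atlas \<Rightarrow> 'm set \<Rightarrow> ('m \<Rightarrow> real) \<Rightarrow> bool" where
  "smooth_fun \<A> W f \<longleftrightarrow> (\<forall>(U, \<phi>)\<in>\<A>. smooth_on (\<phi> ` (U \<inter> W)) (f \<circ> inv_into U \<phi>))"

abbreviation Cinf :: "('m, 'e::real_inner) atlas \<Rightarrow> ('m \<Rightarrow> real) set" where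
  "Cinf \<A> \<equiv> {f. smooth_fun \<A> UNIV f}"

text \<open>Tangent vectors at a point are the derivations at that point of the algebra of smooth functions.\<close>

definition tangent_vector :: "('m, 'e::real_inner) atlas \<Rightarrow> 'm \<Rightarrow> (('m \<Rightarrow> real) \<Rightarrow> real) \<Rightarrow> bool" where
  "tangent_vector \<A> x D \<longleftrightarrow>
     (\<forall>f\<in>Cinf \<A>. \<forall>g\<in>Cinf \<A>. \<forall>a b. D (\<lambda>z. a * f z + b * g z) = a * D f + b * D g) \<and>
     (\<forall>f\<in>Cinf \<A>. \<forall>g\<in>Cinf \<A>. D (\<lambda>z. f z * g z) = D f * g x + f x * D g)"


section \<open>Vector bundles and multisections\<close>

text \<open>
  The fibres are linear subspaces of one real vector space \<open>'v\<close> of arbitrary dimension (no loss of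
  generality: take the direct sum of all fibres).  The total space is \<open>Sigma UNIV fibre\<close>, and a local
  frame \<open>(U, e)\<close> stands for the local trivialization \<open>(x, c) \<mapsto> \<Sum>i. c i *\<^sub>R e i x\<close> over \<open>U\<close>.
\<close>

record ('m, 'v) vbundle =
  fibre :: "'m \<Rightarrow> 'v set"
  rank :: nat
  frames :: "('m set \<times> (nat \<Rightarrow> 'm \<Rightarrow> 'v)) set"

definition vector_bundle ::
  "('m::topological_space, 'e::real_inner) atlas \<Rightarrow> ('m, 'v::real_vector) vbundle \<Rightarrow> bool" where
  "vector_bundle \<A> E \<longleftrightarrow>
     (\<Union>(U, e)\<in>frames E. U) = UNIV \<and>
     (\<forall>(U, e)\<in>frames E. open U \<and>
        (\<forall>x\<in>U. inj_on (\<lambda>i. e i x) {..<rank E} \<and> independent ((\<lambda>i. e i x) ` {..<rank E}) \<and>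
               span ((\<lambda>i. e i x) ` {..<rank E}) = fibre E x)) \<and>
     (\<forall>(U, e)\<in>frames E. \<forall>(V, e')\<in>frames E. \<exists>g :: nat \<Rightarrow> nat \<Rightarrow> 'm \<Rightarrow> real.
        (\<forall>i<rank E. \<forall>j<rank E. smooth_fun \<A> (U \<inter> V) (g i j)) \<and>
        (\<forall>x\<in>U \<inter> V. \<forall>j<rank E. e' j x = (\<Sum>i<rank E. g i j x *\<^sub>R e i x)))"

definition sections ::
  "('m, 'e::real_inner) atlas \<Rightarrow> ('m, 'v::real_vector) vbundle \<Rightarrow> ('m \<Rightarrow> 'v) set" where
  "sections \<A> E =
     {s. (\<forall>x. s x \<in> fibre E x) \<and>
         (\<forall>(U, e)\<in>frames E. \<exists>c :: nat \<Rightarrow> 'm \<Rightarrow> real.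
            (\<forall>i<rank E. smooth_fun \<A> U (c i)) \<and>
            (\<forall>x\<in>U. s x = (\<Sum>i<rank E. c i x *\<^sub>R e i x)))}"

text \<open>
  The frame \<open>e\<close> of \<open>E\<close> induces the frame \<open>e i\<^sub>1 \<and> \<dots> \<and> e i\<^sub>k\<close> (\<open>i\<^sub>1 < \<dots> < i\<^sub>k\<close>) of \<open>\<And>\<^sup>k E\<close>.
\<close>

definition wedge_frame :: "(nat \<Rightarrow> 'm \<Rightarrow> 'v::real_vector) \<Rightarrow> nat set \<Rightarrow> 'm \<Rightarrow> 'v ext" where
  "wedge_frame e I x = prod_list (map (\<lambda>i. gen (e i x)) (sorted_list_of_set I))"

text \<open>
  \<open>msections \<A> E k\<close> is \<open>A\<^sup>k(E)\<close>.  Degrees are integers, \<open>A\<^sup>k(E) = {0}\<close> for \<open>k < 0\<close> and for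
  \<open>k > rank E\<close>.  Membership in the fibres of \<open>\<And>\<^sup>k E\<close> is implied since the frames cover the base.
\<close>

definition msections ::
  "('m, 'e::real_inner) atlas \<Rightarrow> ('m, 'v::real_vector) vbundle \<Rightarrow> int \<Rightarrow> ('m \<Rightarrow> 'v ext) set" where
  "msections \<A> E k =
     {X. \<forall>(U, e)\<in>frames E. \<exists>c :: nat set \<Rightarrow> 'm \<Rightarrow> real.
           (\<forall>I. I \<subseteq> {..<rank E} \<and> int (card I) = k \<longrightarrow> smooth_fun \<A> U (c I)) \<and>
           (\<forall>x\<in>U. X x = (\<Sum>I | I \<subseteq> {..<rank E} \<and> int (card I) = k. c I x *\<^sub>R wedge_frame e I x))}"

definition all_msections ::
  "('m, 'e::real_inner) atlas \<Rightarrow> ('m, 'v::real_vector) vbundle \<Rightarrow> ('m \<Rightarrow> 'v ext) set" where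
  "all_msections \<A> E =
     {X. \<exists>Y. (\<forall>k\<le>rank E. Y k \<in> msections \<A> E (int k)) \<and> X = (\<lambda>x. \<Sum>k\<le>rank E. Y k x)}"

definition part :: "nat \<Rightarrow> ('m \<Rightarrow> 'v::real_vector ext) \<Rightarrow> 'm \<Rightarrow> 'v ext" where
  "part k X = (\<lambda>x. ext_part k (X x))"

definition wedge :: "('m \<Rightarrow> 'v::real_vector ext) \<Rightarrow> ('m \<Rightarrow> 'v ext) \<Rightarrow> 'm \<Rightarrow> 'v ext" where
  "wedge X Y = (\<lambda>x. X x * Y x)"

text \<open>The identifications \<open>C\<^sup>\<infinity>(M) = A\<^sup>0(E)\<close> and \<open>Sec(E) = A\<^sup>1(E)\<close>.\<close>

definition of_fun :: "('m \<Rightarrow> real) \<Rightarrow> 'm \<Rightarrow> 'v::real_vector ext" where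
  "of_fun f = (\<lambda>x. of_real (f x))"

definition of_sec :: "('m \<Rightarrow> 'v::real_vector) \<Rightarrow> 'm \<Rightarrow> 'v ext" where
  "of_sec s = (\<lambda>x. gen (s x))"

definition linear_form_on :: "'v::real_vector set \<Rightarrow> ('v \<Rightarrow> real) \<Rightarrow> bool" where
  "linear_form_on V \<phi> \<longleftrightarrow> (\<forall>v\<in>V. \<forall>w\<in>V. \<forall>a b. \<phi> (a *\<^sub>R v + b *\<^sub>R w) = a * \<phi> v + b * \<phi> w)"

text \<open>\<open>A\<^sup>1(E\<^sup>*)\<close>; the values of \<open>\<Phi> x\<close> outside the fibre over \<open>x\<close> are irrelevant.\<close>

definition dual_sections ::
  "('m, 'e::real_inner) atlas \<Rightarrow> ('m, 'v::real_vector) vbundle \<Rightarrow> ('m \<Rightarrow> 'v \<Rightarrow> real) set" where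
  "dual_sections \<A> E =
     {\<Phi>. (\<forall>x. linear_form_on (fibre E x) (\<Phi> x)) \<and>
         (\<forall>(U, e)\<in>frames E. \<forall>i<rank E. smooth_fun \<A> U (\<lambda>x. \<Phi> x (e i x)))}"


section \<open>Lie algebroids\<close>

text \<open>
  The anchor \<open>\<rho>\<close> is a bundle map to the tangent bundle: \<open>\<rho> x v\<close> is a tangent vector at \<open>x\<close> for
  \<open>v\<close> in the fibre over \<open>x\<close>, and smooth sections are mapped to smooth vector fields.
\<close>

type_synonym ('m, 'v) anchor = "'m \<Rightarrow> 'v \<Rightarrow> ('m \<Rightarrow> real) \<Rightarrow> real"

definition anchor_act :: "('m, 'v) anchor \<Rightarrow> ('m \<Rightarrow> 'v) \<Rightarrow> ('m \<Rightarrow> real) \<Rightarrow> 'm \<Rightarrow> real" where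
  "anchor_act \<rho> X f = (\<lambda>x. \<rho> x (X x) f)"

definition is_anchor ::
  "('m, 'e::real_inner) atlas \<Rightarrow> ('m, 'v::real_vector) vbundle \<Rightarrow> ('m, 'v) anchor \<Rightarrow> bool" where
  "is_anchor \<A> E \<rho> \<longleftrightarrow>
     (\<forall>x. \<forall>v\<in>fibre E x. tangent_vector \<A> x (\<rho> x v)) \<and>
     (\<forall>x. \<forall>f\<in>Cinf \<A>. linear_form_on (fibre E x) (\<lambda>v. \<rho> x v f)) \<and>
     (\<forall>X\<in>sections \<A> E. \<forall>f\<in>Cinf \<A>. anchor_act \<rho> X f \<in> Cinf \<A>)"

definition lie_algebroid ::
  "('m::topological_space, 'e::real_inner) atlas \<Rightarrow> ('m, 'v::real_vector) vbundle \<Rightarrow> ('m, 'v) anchor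
   \<Rightarrow> (('m \<Rightarrow> 'v) \<Rightarrow> ('m \<Rightarrow> 'v) \<Rightarrow> 'm \<Rightarrow> 'v) \<Rightarrow> bool" where
  "lie_algebroid \<A> E \<rho> br \<longleftrightarrow>
     vector_bundle \<A> E \<and>
     is_anchor \<A> E \<rho> \<and>
     (\<forall>X\<in>sections \<A> E. \<forall>Y\<in>sections \<A> E. br X Y \<in> sections \<A> E) \<and>
     (\<forall>X\<in>sections \<A> E. \<forall>Y\<in>sections \<A> E. \<forall>Z\<in>sections \<A> E. \<forall>a b.
        br (\<lambda>x. a *\<^sub>R X x + b *\<^sub>R Y x) Z = (\<lambda>x. a *\<^sub>R br X Z x + b *\<^sub>R br Y Z x)) \<and>
     (\<forall>X\<in>sections \<A> E. \<forall>Y\<in>sections \<A> E. br X Y = (\<lambda>x. - br Y X x)) \<and>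
     (\<forall>X\<in>sections \<A> E. \<forall>Y\<in>sections \<A> E. \<forall>Z\<in>sections \<A> E. \<forall>x.
        br X (br Y Z) x + br Y (br Z X) x + br Z (br X Y) x = 0) \<and>
     (\<forall>X\<in>sections \<A> E. \<forall>Y\<in>sections \<A> E. \<forall>f\<in>Cinf \<A>.
        br X (\<lambda>x. f x *\<^sub>R Y x) = (\<lambda>x. f x *\<^sub>R br X Y x + anchor_act \<rho> X f x *\<^sub>R Y x))"

text \<open>The exterior derivative \<open>d : A\<^sup>1(E\<^sup>*) \<rightarrow> A\<^sup>2(E\<^sup>*)\<close>, evaluated on two sections.\<close>

definition lie_d ::
  "('m, 'v) anchor \<Rightarrow> (('m \<Rightarrow> 'v) \<Rightarrow> ('m \<Rightarrow> 'v) \<Rightarrow> 'm \<Rightarrow> 'v)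
   \<Rightarrow> ('m \<Rightarrow> 'v \<Rightarrow> real) \<Rightarrow> ('m \<Rightarrow> 'v) \<Rightarrow> ('m \<Rightarrow> 'v) \<Rightarrow> 'm \<Rightarrow> real" where
  "lie_d \<rho> br \<Phi> X Y =
     (\<lambda>x. anchor_act \<rho> X (\<lambda>z. \<Phi> z (Y z)) x - anchor_act \<rho> Y (\<lambda>z. \<Phi> z (X z)) x - \<Phi> x (br X Y x))"

definition cocycle ::
  "('m, 'e::real_inner) atlas \<Rightarrow> ('m, 'v::real_vector) vbundle \<Rightarrow> ('m, 'v) anchor
   \<Rightarrow> (('m \<Rightarrow> 'v) \<Rightarrow> ('m \<Rightarrow> 'v) \<Rightarrow> 'm \<Rightarrow> 'v) \<Rightarrow> ('m \<Rightarrow> 'v \<Rightarrow> real) \<Rightarrow> bool" where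
  "cocycle \<A> E \<rho> br \<Phi> \<longleftrightarrow>
     \<Phi> \<in> dual_sections \<A> E \<and>
     (\<forall>X\<in>sections \<A> E. \<forall>Y\<in>sections \<A> E. lie_d \<rho> br \<Phi> X Y = (\<lambda>_. 0))"

text \<open>
  The conditions which characterize the Schouten bracket as an operation on \<open>A(E)\<close>.  The degree of a
  homogeneous \<open>X\<close> is \<open>k\<close>, so that the shifted degree is \<open>k - 1\<close>.
\<close>

definition schouten_bracket ::
  "('m, 'e::real_inner) atlas \<Rightarrow> ('m, 'v::real_vector) vbundle \<Rightarrow> ('m, 'v) anchor
   \<Rightarrow> (('m \<Rightarrow> 'v) \<Rightarrow> ('m \<Rightarrow> 'v) \<Rightarrow> 'm \<Rightarrow> 'v)
   \<Rightarrow> (('m \<Rightarrow> 'v ext) \<Rightarrow> ('m \<Rightarrow> 'v ext) \<Rightarrow> 'm \<Rightarrow> 'v ext) \<Rightarrow> bool" where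
  "schouten_bracket \<A> E \<rho> br S \<longleftrightarrow>
     (\<forall>X\<in>all_msections \<A> E. \<forall>Y\<in>all_msections \<A> E. \<forall>Z\<in>all_msections \<A> E. \<forall>a b.
        S (\<lambda>x. a *\<^sub>R X x + b *\<^sub>R Y x) Z = (\<lambda>x. a *\<^sub>R S X Z x + b *\<^sub>R S Y Z x) \<and>
        S Z (\<lambda>x. a *\<^sub>R X x + b *\<^sub>R Y x) = (\<lambda>x. a *\<^sub>R S Z X x + b *\<^sub>R S Z Y x)) \<and>
     (\<forall>k l. \<forall>X\<in>msections \<A> E k. \<forall>Y\<in>msections \<A> E l. S X Y \<in> msections \<A> E (k + l - 1)) \<and>
     (\<forall>X\<in>sections \<A> E. \<forall>Y\<in>sections \<A> E. S (of_sec X) (of_sec Y) = of_sec (br X Y)) \<and>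
     (\<forall>X\<in>sections \<A> E. \<forall>f\<in>Cinf \<A>. S (of_sec X) (of_fun f) = of_fun (anchor_act \<rho> X f)) \<and>
     (\<forall>k l. \<forall>X\<in>msections \<A> E k. \<forall>Y\<in>msections \<A> E l.
        S X Y = (\<lambda>x. - ((- 1) powi ((k - 1) * (l - 1))) *\<^sub>R S Y X x)) \<and>
     (\<forall>k l j. \<forall>X\<in>msections \<A> E k. \<forall>Y\<in>msections \<A> E l. \<forall>Z\<in>msections \<A> E j.
        S X (wedge Y Z) =
          (\<lambda>x. wedge (S X Y) Z x + ((- 1) powi ((k - 1) * l)) *\<^sub>R wedge Y (S X Z) x))"

text \<open>The conditions which characterize the graded derivation \<open>i\<^sub>\<Phi>\<close> of degree \<open>-1\<close> of \<open>A(E)\<close>.\<close>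

definition contraction ::
  "('m, 'e::real_inner) atlas \<Rightarrow> ('m, 'v::real_vector) vbundle \<Rightarrow> ('m \<Rightarrow> 'v \<Rightarrow> real)
   \<Rightarrow> (('m \<Rightarrow> 'v ext) \<Rightarrow> 'm \<Rightarrow> 'v ext) \<Rightarrow> bool" where
  "contraction \<A> E \<Phi> \<iota> \<longleftrightarrow>
     (\<forall>X\<in>all_msections \<A> E. \<forall>Y\<in>all_msections \<A> E. \<forall>a b.
        \<iota> (\<lambda>x. a *\<^sub>R X x + b *\<^sub>R Y x) = (\<lambda>x. a *\<^sub>R \<iota> X x + b *\<^sub>R \<iota> Y x)) \<and>
     (\<forall>k. \<forall>X\<in>msections \<A> E k. \<iota> X \<in> msections \<A> E (k - 1)) \<and>
     (\<forall>k l. \<forall>X\<in>msections \<A> E k. \<forall>Y\<in>msections \<A> E l.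
        \<iota> (wedge X Y) = (\<lambda>x. wedge (\<iota> X) Y x + ((- 1) powi k) *\<^sub>R wedge X (\<iota> Y) x)) \<and>
     (\<forall>X\<in>sections \<A> E. \<iota> (of_sec X) = of_fun (\<lambda>x. \<Phi> x (X x))) \<and>
     (\<forall>f\<in>Cinf \<A>. \<iota> (of_fun f) = (\<lambda>_. 0))"

text \<open>
  The Schouten-Jacobi bracket, extended bilinearly from homogeneous elements to \<open>A(E)\<close>; \<open>S\<close> is the
  Schouten bracket, \<open>\<iota>\<close> the contraction with the cocycle.
\<close>

definition schouten_jacobi ::
  "('m, 'v::real_vector) vbundle \<Rightarrow> (('m \<Rightarrow> 'v ext) \<Rightarrow> ('m \<Rightarrow> 'v ext) \<Rightarrow> 'm \<Rightarrow> 'v ext)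
   \<Rightarrow> (('m \<Rightarrow> 'v ext) \<Rightarrow> 'm \<Rightarrow> 'v ext) \<Rightarrow> ('m \<Rightarrow> 'v ext) \<Rightarrow> ('m \<Rightarrow> 'v ext) \<Rightarrow> 'm \<Rightarrow> 'v ext" where
  "schouten_jacobi E S \<iota> X Y =
     (\<lambda>p. \<Sum>k\<le>rank E. \<Sum>l\<le>rank E.
        S (part k X) (part l Y) p
        + (real k - 1) *\<^sub>R wedge (part k X) (\<iota> (part l Y)) p
        - ((- 1) powi (int k - 1) * (real l - 1)) *\<^sub>R wedge (\<iota> (part k X)) (part l Y) p)"


section \<open>The extended Lie algebroid\<close>

definition time_atlas :: "('m, 'e::real_inner) atlas \<Rightarrow> ('m \<times> real, 'e \<times> real) atlas" where
  "time_atlas \<A> = (\<lambda>(U, \<phi>). (U \<times> UNIV, \<lambda>(x, t). (\<phi> x, t))) ` \<A>"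

definition time_bundle :: "('m, 'v) vbundle \<Rightarrow> ('m \<times> real, 'v) vbundle" where
  "time_bundle E =
     \<lparr>fibre = (\<lambda>(x, t). fibre E x),
      rank = rank E,
      frames = (\<lambda>(U, e). (U \<times> UNIV, \<lambda>i (x, t). e i x)) ` frames E\<rparr>"

text \<open>The embedding \<open>U\<close> of time-independent sections, and of time-independent multisections.\<close>

definition timeless :: "('m \<Rightarrow> 'b) \<Rightarrow> 'm \<times> real \<Rightarrow> 'b" where
  "timeless X = (\<lambda>(x, t). X x)"

text \<open>\<open>\<rho>(v) + \<langle>\<Phi>, v\<rangle> \<partial>\<^sub>t\<close>\<close>

definition time_anchor :: "('m, 'v) anchor \<Rightarrow> ('m \<Rightarrow> 'v \<Rightarrow> real) \<Rightarrow> ('m \<times> real, 'v) anchor" where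
  "time_anchor \<rho> \<Phi> =
     (\<lambda>(x, t) v f. \<rho> x v (\<lambda>z. f (z, t)) + \<Phi> x v * deriv (\<lambda>s. f (x, s)) t)"

definition extended_lie_algebroid ::
  "('m::topological_space, 'e::real_inner) atlas \<Rightarrow> ('m, 'v::real_vector) vbundle \<Rightarrow> ('m, 'v) anchor
   \<Rightarrow> (('m \<Rightarrow> 'v) \<Rightarrow> ('m \<Rightarrow> 'v) \<Rightarrow> 'm \<Rightarrow> 'v) \<Rightarrow> ('m \<Rightarrow> 'v \<Rightarrow> real)
   \<Rightarrow> (('m \<times> real \<Rightarrow> 'v) \<Rightarrow> ('m \<times> real \<Rightarrow> 'v) \<Rightarrow> 'm \<times> real \<Rightarrow> 'v) \<Rightarrow> bool" where
  "extended_lie_algebroid \<A> E \<rho> br \<Phi> brh \<longleftrightarrow>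
     lie_algebroid (time_atlas \<A>) (time_bundle E) (time_anchor \<rho> \<Phi>) brh \<and>
     (\<forall>X\<in>sections \<A> E. \<forall>Y\<in>sections \<A> E. brh (timeless X) (timeless Y) = timeless (br X Y))"

text \<open>The linear map which sends \<open>X\<close> of degree \<open>k\<close> to \<open>exp (- (k - 1) t) U(X)\<close>.\<close>

definition Utilde ::
  "('m, 'v::real_vector) vbundle \<Rightarrow> ('m \<Rightarrow> 'v ext) \<Rightarrow> 'm \<times> real \<Rightarrow> 'v ext" where
  "Utilde E X =
     (\<lambda>(x, t). \<Sum>k\<le>rank E. exp (- (real k - 1) * t) *\<^sub>R timeless (part k X) (x, t))"

end

theory Submission
  imports Defs "HOL-Real_Asymp.Real_Asymp"
begin

text \<open>
  For a function \<open>f\<close> of \<open>t\<close> alone, \<open>\<lbrakk>f, U(\<cdot>)\<rbrakk>\<close> and \<open>- f' U \<circ> i\<^sub>\<Phi>\<close> are derivations of degree \<open>-1\<close> on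
  \<open>A(E)\<close> which agree on functions and sections, hence are equal.  In the same way \<open>\<lbrakk>U(X), U(Y)\<rbrakk>\<close> and
  \<open>U(\<lbrakk>X, Y\<rbrakk>)\<close> agree, first with \<open>X\<close> a function or a section, then, by antisymmetry, in general.  The
  formula follows by expanding \<open>\<lbrakk>e\<^sup>-\<^sup>x\<^sup>t U(X), e\<^sup>-\<^sup>y\<^sup>t U(Y)\<rbrakk>\<close> with the Leibniz rule.  Bump functions reduce the
  uniqueness of such derivations to a frame.
\<close>

section \<open>Maps of class \<open>C\<^sup>k\<close>\<close>

text \<open>The weights match because the bracket is additive in shifted degrees:
  \<open>S X Y\<close> has shifted degree x + y, so the product of the weights of X and Y is the
  weight that \<open>Utilde\<close> gives to the result.

  Two obstacles shape the argument. The brackets and the contraction are operators on global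
  multisections with no locality postulated, while multisections are described only in local frames;
  locality must be extracted from the Leibniz rule. Moreover, that rule is postulated for the
  bracket in its second argument alone, so every manipulation of the first argument passes through
  antisymmetry.

  Comparisons are made at one point (p, t) and only as functions of a multisection over M. Hence the
  bump functions and frames are those of M, although one of the brackets lives over the product with
  the time axis. The model space is an inner product space with a finite spanning set, possibly
  zero-dimensional, so coordinates are taken with respect to a finite orthogonal spanning
  set.\<close>

lemma Ck_on_subset: "Ck_on k S f \<Longrightarrow> T \<subseteq> S \<Longrightarrow> Ck_on k T f"
  by (induction k arbitrary: f) (auto intro: continuous_on_subset)

lemma frechet_derivative_eqI: "(f has_derivative F) (at x) \<Longrightarrow> frechet_derivative f (at x) = F"
  by (metis frechet_derivative_at)

text \<open>On an open set, agreement on \<open>S\<close> is agreement near each of its points, so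
  the derivatives agree as well and the induction can go on.\<close>

lemma Ck_on_cong:
  assumes "open S" "\<And>x. x \<in> S \<Longrightarrow> f x = g x" "Ck_on k S f"
  shows "Ck_on k S g"
  using assms(2,3)
proof (induction k arbitrary: f g)
  case 0
  then show ?case by (simp cong: continuous_on_cong)
next
  case (Suc k)
  have d: "(g has_derivative frechet_derivative f (at x)) (at x)" if "x \<in> S" for x
  proof -
    have "(f has_derivative frechet_derivative f (at x)) (at x)"
      using Suc.prems(2) that by (simp add: frechet_derivative_works)
    then show ?thesis
      by (rule has_derivative_transform_within_open[OF _ assms(1) that]) (rule Suc.prems(1))
  qed
  have "Ck_on k S (\<lambda>x. frechet_derivative g (at x) v)" for v
    by (rule Suc.IH[of "\<lambda>x. frechet_derivative f (at x) v"])
      (use Suc.prems(2) in \<open>simp_all add: frechet_derivative_eqI[OF d]\<close>)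
  then show ?case using d by (auto simp: differentiable_def)
qed

text \<open>The definition of \<open>Ck_on\<close> speaks of the chosen
  \<open>frechet_derivative\<close>; here any explicit derivative \<open>F\<close> serves in its
  place.\<close>

lemma Ck_on_SucI:
  assumes "open S" "\<And>x. x \<in> S \<Longrightarrow> (f has_derivative F x) (at x)" "\<And>v. Ck_on k S (\<lambda>x. F x v)"
  shows "Ck_on (Suc k) S f"
proof -
  have "Ck_on k S (\<lambda>x. frechet_derivative f (at x) v)" for v
    by (rule Ck_on_cong[OF assms(1) _ assms(3)[of v]]) (simp add: frechet_derivative_eqI[OF assms(2)])
  then show ?thesis using assms(2) by (auto simp: differentiable_def)
qed

lemma Ck_on_has_derivative:
  "Ck_on (Suc k) S f \<Longrightarrow> x \<in> S \<Longrightarrow> (f has_derivative frechet_derivative f (at x)) (at x)"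
  by (simp add: frechet_derivative_works)

lemma Ck_on_frechet: "Ck_on (Suc k) S f \<Longrightarrow> Ck_on k S (\<lambda>x. frechet_derivative f (at x) v)"
  by simp

lemma Ck_on_SucD: "Ck_on (Suc k) S f \<Longrightarrow> Ck_on k S f"
proof (induction k arbitrary: f)
  case 0
  then show ?case
    by (auto intro!: continuous_at_imp_continuous_on differentiable_imp_continuous_within)
next
  case (Suc k)
  from Suc.prems have "\<forall>x\<in>S. f differentiable at x"
    "\<forall>v. Ck_on (Suc k) S (\<lambda>x. frechet_derivative f (at x) v)"
    by auto
  then show ?case by (auto intro: Suc.IH simp del: Ck_on.simps(2) simp: Ck_on.simps(2)[of k S f])
qed

text \<open>Derivatives are taken \<open>at x\<close> and not within \<open>S\<close>, so each level
  of the definition is a local condition. This is what glues smooth functions over a union of open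
  sets.\<close>

lemma Ck_on_local:
  assumes "\<And>x. x \<in> S \<Longrightarrow> \<exists>T. open T \<and> x \<in> T \<and> Ck_on k T f"
  shows "Ck_on k S f"
  using assms
proof (induction k arbitrary: f)
  case 0
  have "isCont f x" if "x \<in> S" for x
    using 0[OF that] by (auto simp: continuous_on_eq_continuous_at)
  then show ?case by (simp add: continuous_at_imp_continuous_on)
next
  case (Suc k)
  have "f differentiable at x" if "x \<in> S" for x
    using Suc.prems[OF that] by auto
  moreover have "Ck_on k S (\<lambda>x. frechet_derivative f (at x) v)" for v
    by (rule Suc.IH) (use Suc.prems in fastforce)
  ultimately show ?case by simp
qed

section \<open>Closure properties of maps of class C^k\<close>

lemma Ck_on_const: "open S \<Longrightarrow> Ck_on k S (\<lambda>x. c)"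
proof (induction k arbitrary: c)
  case (Suc k)
  show ?case
    by (rule Ck_on_SucI[OF Suc.prems, where F = "\<lambda>x v. 0"]) (use Suc in auto)
qed simp

lemma Ck_on_add:
  assumes "open S"
  shows "Ck_on k S f \<Longrightarrow> Ck_on k S g \<Longrightarrow> Ck_on k S (\<lambda>x. f x + g x)"
proof (induction k arbitrary: f g)
  case 0
  then show ?case by (simp add: continuous_on_add)
next
  case (Suc k)
  show ?case
    by (rule Ck_on_SucI[OF assms has_derivative_add[OF
            Ck_on_has_derivative[OF Suc.prems(1)] Ck_on_has_derivative[OF Suc.prems(2)]]])
      (use Suc in auto)
qed

lemma Ck_on_sum:
  assumes "open S"
  shows "(\<And>i. i \<in> I \<Longrightarrow> Ck_on k S (f i)) \<Longrightarrow> Ck_on k S (\<lambda>x. \<Sum>i\<in>I. f i x)"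
  by (induction I rule: infinite_finite_induct) (auto intro: Ck_on_const Ck_on_add assms)

lemma Ck_on_bounded_linear:
  assumes "open S" "bounded_linear L"
  shows "Ck_on k S f \<Longrightarrow> Ck_on k S (\<lambda>x. L (f x))"
proof (induction k arbitrary: f)
  case 0
  then show ?case by (simp add: bounded_linear.continuous_on[OF assms(2)])
next
  case (Suc k)
  show ?case
    by (rule Ck_on_SucI[OF assms(1) bounded_linear.has_derivative[OF assms(2)
            Ck_on_has_derivative[OF Suc.prems]]]) (use Suc in auto)
qed

lemma Ck_on_mult:
  fixes f g :: "'a::real_normed_vector \<Rightarrow> real"
  assumes "open S"
  shows "Ck_on k S f \<Longrightarrow> Ck_on k S g \<Longrightarrow> Ck_on k S (\<lambda>x. f x * g x)"
proof (induction k arbitrary: f g)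
  case 0
  then show ?case by (simp add: continuous_on_mult)
next
  case (Suc k)
  show ?case
    by (rule Ck_on_SucI[OF assms has_derivative_mult[OF
            Ck_on_has_derivative[OF Suc.prems(1)] Ck_on_has_derivative[OF Suc.prems(2)]]])
      (assumption | intro Ck_on_add[OF assms] Suc.IH Ck_on_frechet Suc.prems Ck_on_SucD)+
qed

lemma Ck_on_id: "open S \<Longrightarrow> Ck_on k S (\<lambda>x. x)"
proof (cases k)
  case (Suc j)
  assume "open S"
  then show ?thesis
    unfolding Suc by (rule Ck_on_SucI[where F = "\<lambda>x v. v"]) (auto intro: Ck_on_const \<open>open S\<close>)
qed simp

lemma Ck_on_compose_linear:
  assumes "open S" "bounded_linear L" "L ` S \<subseteq> T"
  shows "Ck_on k T f \<Longrightarrow> Ck_on k S (\<lambda>x. f (L x))"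
proof (induction k arbitrary: f)
  case 0
  then show ?case
    using continuous_on_compose2[OF _ linear_continuous_on[OF assms(2)] assms(3)] by simp
next
  case (Suc k)
  show ?case
  proof (rule Ck_on_SucI[OF assms(1)])
    fix x assume "x \<in> S"
    then have "L x \<in> T" using assms(3) by auto
    show "((\<lambda>x. f (L x)) has_derivative (\<lambda>v. frechet_derivative f (at (L x)) (L v))) (at x)"
      by (rule has_derivative_compose[OF bounded_linear_imp_has_derivative[OF assms(2)]
            Ck_on_has_derivative[OF Suc.prems \<open>L x \<in> T\<close>]])
  qed (use Suc in auto)
qed

text \<open>This supplies coordinates in the model space: the coefficients are inner products, hence
  bounded linear in \<open>w\<close>.\<close>

lemma orthogonal_expansion:
  fixes w :: "'a::real_inner"
  assumes "finite B" "pairwise orthogonal B" "w \<in> span B"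
  shows "w = (\<Sum>b\<in>B. (inner w b / inner b b) *\<^sub>R b)"
proof -
  obtain u where u: "w = (\<Sum>b\<in>B. u b *\<^sub>R b)"
    using assms(3) by (auto simp: span_finite[OF assms(1)])
  \<comment> \<open>The factor \<open>b\<close> stays on both sides because \<open>B\<close> may
    contain 0, where the two coefficients can differ but both terms vanish.\<close>
  have "(inner w b / inner b b) *\<^sub>R b = u b *\<^sub>R b" if "b \<in> B" for b
  proof -
    have "inner w b = (\<Sum>c\<in>B. u c * inner c b)"
      by (simp add: u inner_sum_left)
    also have "\<dots> = (\<Sum>c\<in>{b}. u c * inner c b)"
      using assms(1,2) that
      by (intro sum.mono_neutral_right) (auto simp: pairwise_def orthogonal_def)
    finally show ?thesis by auto
  qed
  then show ?thesis using u by (metis (no_types, lifting) sum.cong)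
qed

lemma finite_orthogonal_span:
  assumes "finite (B :: 'a::real_inner set)" "span B = UNIV"
  obtains C :: "'a::real_inner set" where "finite C" "pairwise orthogonal C" "span C = UNIV"
  using basis_orthogonal[OF assms(1)] assms(2) that by auto

text \<open>In the derivative f'(g x) (g'(x) v) both the base point and the direction depend on x,
  so the induction hypothesis does not apply to it directly. Expanding g'(x) v in an orthogonal
  spanning set leaves derivatives of \<open>f\<close> in fixed directions \<open>b\<close>,
  multiplied by coordinates of g'(x) v.\<close>

lemma Ck_on_compose:
  fixes g :: "'a::real_normed_vector \<Rightarrow> 'b::real_inner" and f :: "'b \<Rightarrow> real"
  assumes "finite (B :: 'b set)" "span B = UNIV" "open S" "g ` S \<subseteq> T"
  shows "Ck_on k S g \<Longrightarrow> Ck_on k T f \<Longrightarrow> Ck_on k S (\<lambda>x. f (g x))"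
proof (induction k arbitrary: f)
  case 0
  then show ?case using continuous_on_compose2 assms(4) by (simp, blast)
next
  case (Suc k)
  obtain C :: "'b set" where C: "finite C" "pairwise orthogonal C" "span C = UNIV"
    by (rule finite_orthogonal_span[OF assms(1,2)])
  show ?case
  proof (rule Ck_on_SucI[OF assms(3)])
    fix x assume "x \<in> S"
    then have gx: "g x \<in> T" using assms(4) by auto
    let ?g = "frechet_derivative g (at x)" and ?f = "frechet_derivative f (at (g x))"
    have lin: "linear ?f"
      using Ck_on_has_derivative[OF Suc.prems(2) gx]
      by (simp add: has_derivative_linear)
    have "?f (?g v) = (\<Sum>b\<in>C. inner (?g v) b * (1 / inner b b) * ?f b)" for v
      by (subst orthogonal_expansion[OF C(1,2), of "?g v"])
        (simp_all add: C(3) linear_sum[OF lin] linear_cmul[OF lin])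
    moreover have "((\<lambda>x. f (g x)) has_derivative (\<lambda>v. ?f (?g v))) (at x)"
      by (rule has_derivative_compose[OF Ck_on_has_derivative[OF Suc.prems(1) \<open>x \<in> S\<close>]
            Ck_on_has_derivative[OF Suc.prems(2) gx]])
    ultimately show "((\<lambda>x. f (g x)) has_derivative
        (\<lambda>v. \<Sum>b\<in>C. inner (?g v) b * (1 / inner b b) * ?f b)) (at x)"
      by simp
  next
    fix v
    show "Ck_on k S (\<lambda>x. \<Sum>b\<in>C. inner (frechet_derivative g (at x) v) b * (1 / inner b b)
            * frechet_derivative f (at (g x)) b)"
      by (intro Ck_on_sum[OF assms(3)] Ck_on_mult[OF assms(3)] Ck_on_const[OF assms(3)]
          Ck_on_bounded_linear[OF assms(3) bounded_linear_inner_left]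
          Ck_on_frechet Suc.IH Ck_on_SucD[OF Suc.prems(1)] Suc.prems)
  qed
qed


section \<open>Bump functions\<close>

text \<open>The member \<open>flat 0\<close> is the classical smooth function vanishing for u \<le>
  0. The others make the family closed under differentiation up to linear combinations, so that one
  induction over all \<open>n\<close> gives smoothness.\<close>

definition flat :: "nat \<Rightarrow> real \<Rightarrow> real" where
  "flat n u = (if u > 0 then exp (- (1 / u)) / u ^ n else 0)"

lemma flat_has_derivative: "(flat n has_real_derivative (flat (n + 2) u - real n * flat (n + 1) u)) (at u)"
proof -
  consider "u > 0" | "u < 0" | "u = 0" by linarith
  then show ?thesis
  proof cases
    case 1
    have "((\<lambda>u. exp (- (1 / u)) / u ^ n) has_real_derivative (flat (n + 2) u - real n * flat (n + 1) u)) (at u)"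
    proof -
      have "((\<lambda>u. exp (- (1 / u)) / u ^ n) has_real_derivative
          (exp (- (1 / u)) * (1 / (u * u)) * u ^ n - exp (- (1 / u)) * (real n * u ^ (n - 1))) / (u ^ n * u ^ n)) (at u)"
        using 1 by (auto intro!: derivative_eq_intros)
      \<comment> \<open>Here \<open>w\<close> and \<open>v\<close> stand for \<open>u ^ n\<close>
        and \<open>u ^ (n - 1)\<close>. Their relation is multiplied by \<open>n\<close> so that it
        survives n = 0, where the exponent n - 1 is truncated.\<close>
      moreover have "(E * (1 / (u * u)) * w - E * (real n * v)) / (w * w) = E / (u * u * w) - real n * (E / (u * w))"
        if "real n * w = real n * (u * v)" "w > 0" for E v w :: real
      proof -
        have "(E * (1 / (u * u)) * w - E * (real n * v)) / (w * w)
            = (E * (1 / (u * u)) * w * u - E * (real n * (u * v))) / (w * w * u)"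
          using 1 that(2) by (simp add: field_simps)
        then show ?thesis unfolding that(1)[symmetric] using 1 that(2) by (simp add: field_simps)
      qed
      moreover have "real n * u ^ n = real n * (u * u ^ (n - 1))"
        by (cases n) auto
      ultimately show ?thesis using 1 by (simp add: flat_def mult.assoc)
    qed
    then show ?thesis
      by (rule has_field_derivative_transform_within_open[where S = "{0<..}"])
        (use 1 in \<open>auto simp: flat_def\<close>)
  next
    case 2
    have "((\<lambda>u. 0) has_real_derivative (flat (n + 2) u - real n * flat (n + 1) u)) (at u)"
      using 2 by (auto simp: flat_def)
    then show ?thesis
      by (rule has_field_derivative_transform_within_open[where S = "{..<0}"])
        (use 2 in \<open>auto simp: flat_def\<close>)
  next
    case 3
    \<comment> \<open>This is the difference quotient at 0 from the right; from the left it is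
      identically 0.\<close>
    have "((\<lambda>u::real. exp (- (1 / u)) / u ^ n / u) \<longlongrightarrow> 0) (at_right 0)"
      by real_asymp
    then have "((\<lambda>u. flat n u / u) \<longlongrightarrow> 0) (at_right 0)"
      by (rule Lim_transform_eventually) (auto simp: flat_def eventually_at_filter)
    moreover have "((\<lambda>u. flat n u / u) \<longlongrightarrow> 0) (at_left 0)"
      by (rule Lim_transform_eventually[OF tendsto_const]) (auto simp: flat_def eventually_at_filter)
    ultimately have "((\<lambda>u. flat n u / u) \<longlongrightarrow> 0) (at 0)"
      by (simp add: filterlim_split_at)
    then show ?thesis
      using 3 by (simp add: has_field_derivative_iff flat_def)
  qed
qed

lemma Ck_on_flat: "Ck_on k UNIV (flat n)"
proof (induction k arbitrary: n)
  case 0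
  then show ?case
    using flat_has_derivative by (auto intro!: DERIV_continuous_on)
next
  case (Suc k)
  have "Ck_on k UNIV (\<lambda>u. (flat (n + 2) u + (- real n) * flat (n + 1) u) * v)" for v
    by (intro Ck_on_mult Ck_on_add Ck_on_const Suc.IH open_UNIV)
  moreover have "(flat n has_derivative (\<lambda>v. (flat (n + 2) u + (- real n) * flat (n + 1) u) * v)) (at u)" for u
    using flat_has_derivative[of n u] by (simp add: has_field_derivative_def)
  ultimately show ?case by (intro Ck_on_SucI) auto
qed

text \<open>The ball is a closed subset of a compact set: the combinations of an orthogonal spanning
  set with bounded coefficients, a finite sum of segments. Compactness is wanted for the supports of
  bump functions, which are thereby closed in the Hausdorff space M.\<close>

lemma compact_cball_finite_span:
  fixes c :: "'a::real_inner"
  assumes "finite B" "span B = (UNIV :: 'a set)"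
  shows "compact (cball c r)"
proof -
  obtain C :: "'a set" where C: "finite C" "pairwise orthogonal C" "span C = UNIV"
    by (rule finite_orthogonal_span[OF assms])
  \<comment> \<open>By the Cauchy-Schwarz inequality, \<open>r / norm b\<close> bounds the
    coefficient at \<open>b\<close> of any vector of norm at most \<open>r\<close>. For b = 0 both
    the bound and the coefficient are 0.\<close>
  define K where "K C = {\<Sum>b\<in>C. u b *\<^sub>R b |u. \<forall>b\<in>C. \<bar>u b\<bar> \<le> r / norm b}" for C :: "'a set"
  have "compact (K C)" using C(1)
  proof (induction C rule: finite_induct)
    case empty
    then show ?case by (simp add: K_def)
  next
    case (insert a C)
    have "K (insert a C) = {x + y |x y. x \<in> (\<lambda>t. t *\<^sub>R a) ` {- r / norm a..r / norm a} \<and> y \<in> K C}"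
    proof (intro set_eqI iffI)
      fix w assume "w \<in> K (insert a C)"
      then obtain u where u: "w = (\<Sum>b\<in>insert a C. u b *\<^sub>R b)" "\<forall>b\<in>insert a C. \<bar>u b\<bar> \<le> r / norm b"
        by (auto simp: K_def)
      have "w = u a *\<^sub>R a + (\<Sum>b\<in>C. u b *\<^sub>R b)" using insert u by simp
      moreover have "u a \<in> {- r / norm a..r / norm a}" using u(2) by auto
      moreover have "(\<Sum>b\<in>C. u b *\<^sub>R b) \<in> K C" using u(2) by (auto simp: K_def)
      ultimately show "w \<in> {x + y |x y. x \<in> (\<lambda>t. t *\<^sub>R a) ` {- r / norm a..r / norm a} \<and> y \<in> K C}"
        by blast
    next
      fix w assume "w \<in> {x + y |x y. x \<in> (\<lambda>t. t *\<^sub>R a) ` {- r / norm a..r / norm a} \<and> y \<in> K C}"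
      then obtain t u where tu: "w = t *\<^sub>R a + (\<Sum>b\<in>C. u b *\<^sub>R b)" "\<bar>t\<bar> \<le> r / norm a"
        "\<forall>b\<in>C. \<bar>u b\<bar> \<le> r / norm b"
        by (auto simp: K_def abs_le_iff)
      have "w = (\<Sum>b\<in>insert a C. (u(a := t)) b *\<^sub>R b)"
        using insert(1,2) tu(1) by (simp, intro sum.cong) auto
      moreover have "\<forall>b\<in>insert a C. \<bar>(u(a := t)) b\<bar> \<le> r / norm b" using tu by auto
      ultimately show "w \<in> K (insert a C)" unfolding K_def by blast
    qed
    moreover have "compact ((\<lambda>t. t *\<^sub>R a) ` {- r / norm a..r / norm a})"
      by (intro compact_continuous_image continuous_intros compact_Icc)
    ultimately show ?case using compact_sums insert.IH by simp
  qed
  moreover have "cball 0 r \<subseteq> K C"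
  proof
    fix w assume "w \<in> cball (0::'a) r"
    then have "norm w \<le> r" by simp
    have "\<bar>inner w b / inner b b\<bar> \<le> r / norm b" for b
    proof (cases "b = 0")
      case False
      have "\<bar>inner w b\<bar> \<le> r * norm b"
        using Cauchy_Schwarz_ineq2[of w b] mult_right_mono[OF \<open>norm w \<le> r\<close>, of "norm b"] by simp
      then have "\<bar>inner w b\<bar> / (norm b * norm b) \<le> r * norm b / (norm b * norm b)"
        by (intro divide_right_mono) auto
      then show ?thesis using False by (simp add: power2_norm_eq_inner[symmetric] power2_eq_square)
    qed simp
    then show "w \<in> K C"
      unfolding K_def using orthogonal_expansion[OF C(1,2), of w] C(3)
      by (intro CollectI exI[of _ "\<lambda>b. inner w b / inner b b"]) auto
  qed
  ultimately have "compact (cball (0::'a) r)"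
    using compact_Int_closed[of "K C" "cball 0 r"] by (simp add: Int_absorb1)
  then have "compact ((+) c ` cball 0 r)"
    by (rule compact_translation)
  then show ?thesis by simp
qed


section \<open>Smooth functions on manifolds\<close>

text \<open>This part of the manifold axioms is all that the calculus of smooth functions uses; it passes
  easily to the product with the time axis.\<close>

definition open_charts :: "('m::topological_space, 'e::real_inner) atlas \<Rightarrow> bool" where
  "open_charts \<A> \<longleftrightarrow> (\<forall>(U, \<phi>)\<in>\<A>. inj_on \<phi> U \<and> (\<forall>W. open W \<longrightarrow> open (\<phi> ` (U \<inter> W))))"

lemma open_charts_image: "open_charts \<A> \<Longrightarrow> (U, \<phi>) \<in> \<A> \<Longrightarrow> open W \<Longrightarrow> open (\<phi> ` (U \<inter> W))"
  by (auto simp: open_charts_def)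

lemma open_charts_manifold:
  assumes "smooth_manifold \<A>"
  shows "open_charts \<A>"
proof -
  have "inj_on \<phi> U \<and> open (\<phi> ` (U \<inter> W))" if "(U, \<phi>) \<in> \<A>" "open W" for U \<phi> W
  proof -
    have h: "open (\<phi> ` U)" "homeomorphism U (\<phi> ` U) \<phi> (inv_into U \<phi>)"
      using assms that(1) by (auto simp: smooth_manifold_def)
    have "openin (top_of_set U) (U \<inter> W)"
      using that(2) by (simp add: openin_open_Int)
    then have "openin (top_of_set (\<phi> ` U)) (\<phi> ` (U \<inter> W))"
      using h(2) homeomorphism_imp_open_map by blast
    moreover have "inj_on \<phi> U"
      using h(2) by (metis homeomorphism_apply1 inj_on_inverseI)
    ultimately show ?thesis using h(1) openin_open_trans by blast
  qed
  then show ?thesis by (auto simp: open_charts_def)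
qed

lemma smooth_funI:
  "(\<And>U \<phi> k. (U, \<phi>) \<in> \<A> \<Longrightarrow> Ck_on k (\<phi> ` (U \<inter> W)) (\<lambda>a. f (inv_into U \<phi> a))) \<Longrightarrow> smooth_fun \<A> W f"
  by (auto simp: smooth_fun_def smooth_on_def comp_def)

lemma smooth_funD:
  "smooth_fun \<A> W f \<Longrightarrow> (U, \<phi>) \<in> \<A> \<Longrightarrow> Ck_on k (\<phi> ` (U \<inter> W)) (\<lambda>a. f (inv_into U \<phi> a))"
  by (auto simp: smooth_fun_def smooth_on_def comp_def)

lemma smooth_fun_subset: "smooth_fun \<A> W f \<Longrightarrow> V \<subseteq> W \<Longrightarrow> smooth_fun \<A> V f"
  by (rule smooth_funI, rule Ck_on_subset[OF smooth_funD]) auto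

lemma smooth_fun_const: "open_charts \<A> \<Longrightarrow> open W \<Longrightarrow> smooth_fun \<A> W (\<lambda>x. c)"
  by (rule smooth_funI) (intro Ck_on_const open_charts_image)

lemma smooth_fun_add:
  "open_charts \<A> \<Longrightarrow> open W \<Longrightarrow> smooth_fun \<A> W f \<Longrightarrow> smooth_fun \<A> W g \<Longrightarrow> smooth_fun \<A> W (\<lambda>x. f x + g x)"
  by (rule smooth_funI) (intro Ck_on_add open_charts_image smooth_funD)

lemma smooth_fun_mult:
  "open_charts \<A> \<Longrightarrow> open W \<Longrightarrow> smooth_fun \<A> W f \<Longrightarrow> smooth_fun \<A> W g \<Longrightarrow> smooth_fun \<A> W (\<lambda>x. f x * g x)"
  by (rule smooth_funI) (intro Ck_on_mult open_charts_image smooth_funD)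

lemma smooth_fun_power:
  "open_charts \<A> \<Longrightarrow> open W \<Longrightarrow> smooth_fun \<A> W f \<Longrightarrow> smooth_fun \<A> W (\<lambda>x. f x ^ n)"
  by (induction n) (auto intro: smooth_fun_const smooth_fun_mult)

lemma smooth_fun_cong:
  assumes "open_charts \<A>" "open W" "\<And>x. x \<in> W \<Longrightarrow> f x = g x" "smooth_fun \<A> W f"
  shows "smooth_fun \<A> W g"
proof (rule smooth_funI)
  fix U \<phi> k assume U: "(U, \<phi>) \<in> \<A>"
  have "inj_on \<phi> U" using assms(1) U by (auto simp: open_charts_def)
  then show "Ck_on k (\<phi> ` (U \<inter> W)) (\<lambda>a. g (inv_into U \<phi> a))"
    using assms(3)
    by (intro Ck_on_cong[OF open_charts_image[OF assms(1) U assms(2)] _ smooth_funD[OF assms(4) U]]) auto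
qed

lemma smooth_fun_Un:
  assumes "open_charts \<A>" "open V" "open W" "smooth_fun \<A> V f" "smooth_fun \<A> W f"
  shows "smooth_fun \<A> (V \<union> W) f"
proof (rule smooth_funI, rule Ck_on_local)
  fix U \<phi> k a assume U: "(U, \<phi>) \<in> \<A>" and "a \<in> \<phi> ` (U \<inter> (V \<union> W))"
  then consider "a \<in> \<phi> ` (U \<inter> V)" | "a \<in> \<phi> ` (U \<inter> W)" by blast
  then show "\<exists>T. open T \<and> a \<in> T \<and> Ck_on k T (\<lambda>a. f (inv_into U \<phi> a))"
    using open_charts_image[OF assms(1) U] assms(2,3) smooth_funD[OF assms(4) U] smooth_funD[OF assms(5) U]
    by cases blast+
qed

text \<open>A radial profile in one chart is extended by 0. The result is smooth on the chart
  domain, where it is the profile in coordinates, and on the complement of the compact set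
  \<open>K\<close>, where it is 0; both sets are open since \<open>K\<close> is closed, and they
  cover M.\<close>

lemma smooth_bump:
  fixes \<A> :: "('m::{t2_space, second_countable_topology}, 'e::real_inner) atlas"
  assumes man: "smooth_manifold \<A>" and "open U" "p \<in> U"
  obtains \<beta> K where "smooth_fun \<A> UNIV \<beta>" "\<beta> p = 1" "closed K" "K \<subseteq> U" "\<And>x. x \<notin> K \<Longrightarrow> \<beta> x = 0"
proof -
  note oc = open_charts_manifold[OF man]
  obtain B :: "'e set" where B: "finite B" "span B = UNIV"
    using man by (auto simp: smooth_manifold_def)
  have "p \<in> (\<Union>(U, \<phi>)\<in>\<A>. U)" using man by (simp add: smooth_manifold_def)
  then obtain V \<phi> where V: "(V, \<phi>) \<in> \<A>" "p \<in> V" by auto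
  have oV: "open V" and hV: "homeomorphism V (\<phi> ` V) \<phi> (inv_into V \<phi>)"
    using man V(1) by (auto simp: smooth_manifold_def)
  have inj: "inj_on \<phi> V" using oc V(1) by (auto simp: open_charts_def)
  define c where "c = \<phi> p"
  have "open (\<phi> ` (V \<inter> U))" "c \<in> \<phi> ` (V \<inter> U)"
    using open_charts_image[OF oc V(1) \<open>open U\<close>] V(2) \<open>p \<in> U\<close> by (auto simp: c_def)
  then obtain r where r: "r > 0" "cball c r \<subseteq> \<phi> ` (V \<inter> U)"
    using open_contains_cball by blast
  define K where "K = inv_into V \<phi> ` cball c r"
  have sub: "cball c r \<subseteq> \<phi> ` V" using r(2) by auto
  have "continuous_on (cball c r) (inv_into V \<phi>)"
    using continuous_on_subset[OF homeomorphism_cont2[OF hV] sub] .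
  then have "compact K"
    unfolding K_def by (rule compact_continuous_image) (rule compact_cball_finite_span[OF B])
  then have "closed K" by (rule compact_imp_closed)
  have "K \<subseteq> U"
    using r(2) inj by (force simp: K_def)
  have K_iff: "x \<in> K \<longleftrightarrow> \<phi> x \<in> cball c r" if "x \<in> V" for x
  proof
    assume "x \<in> K"
    then obtain a where "a \<in> cball c r" "x = inv_into V \<phi> a" by (auto simp: K_def)
    then show "\<phi> x \<in> cball c r" using sub by (metis f_inv_into_f subsetD)
  next
    assume "\<phi> x \<in> cball c r"
    then show "x \<in> K" unfolding K_def using inj that by (metis image_eqI inv_into_f_f)
  qed
  \<comment> \<open>The argument of \<open>flat 0\<close> is positive exactly on the open ball of
    radius \<open>r\<close>; the denominator normalizes the value at the centre to 1.\<close>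
  define F where "F = (\<lambda>a. flat 0 (r\<^sup>2 - inner (a - c) (a - c)) / flat 0 (r\<^sup>2))"
  have F_smooth: "Ck_on k UNIV F" for k
  proof -
    have sq: "Ck_on k UNIV (\<lambda>a. inner (a - c) (a - c))" for k
    proof (cases k)
      case (Suc j)
      have "((\<lambda>a. inner (a - c) (a - c)) has_derivative (\<lambda>v. 2 * inner a v + (- 2) * inner c v)) (at a)" for a
        by (auto intro!: derivative_eq_intros simp: inner_diff inner_commute algebra_simps)
      moreover have "Ck_on j UNIV (\<lambda>a. 2 * inner a v + (- 2) * inner c v)" for v
        by (intro Ck_on_add Ck_on_mult Ck_on_const Ck_on_id open_UNIV
            Ck_on_bounded_linear[OF _ bounded_linear_inner_left])
      ultimately show ?thesis unfolding Suc by (intro Ck_on_SucI) auto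
    qed (auto intro!: continuous_intros)
    have "Ck_on k UNIV (\<lambda>a. r\<^sup>2 + (- 1) * inner (a - c) (a - c))"
      by (intro Ck_on_add Ck_on_mult Ck_on_const sq open_UNIV)
    then have "Ck_on k UNIV (\<lambda>a. flat 0 (r\<^sup>2 + (- 1) * inner (a - c) (a - c)))"
      \<comment> \<open>The chain rule is used with the reals as intermediate space, spanned by
        \<open>{1}\<close>.\<close>
      by (rule Ck_on_compose[of "{1}" UNIV _ UNIV, rotated 4]) (auto intro: Ck_on_flat simp: span_singleton)
    then have "Ck_on k UNIV (\<lambda>a. flat 0 (r\<^sup>2 + (- 1) * inner (a - c) (a - c)) * inverse (flat 0 (r\<^sup>2)))"
      by (intro Ck_on_mult Ck_on_const open_UNIV)
    then show ?thesis by (simp add: F_def divide_inverse)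
  qed
  have F_zero: "F a = 0" if "a \<notin> cball c r" for a
  proof -
    have "r < norm (a - c)" using that by (simp add: dist_norm norm_minus_commute)
    then have "r\<^sup>2 < (norm (a - c))\<^sup>2" using r(1) by (intro power_strict_mono) auto
    then show ?thesis by (simp add: F_def flat_def power2_norm_eq_inner)
  qed
  define \<beta> where "\<beta> = (\<lambda>x. if x \<in> K then F (\<phi> x) else 0)"
  have "smooth_fun \<A> V (\<lambda>x. F (\<phi> x))"
  proof (rule smooth_funI)
    fix W \<psi> k assume W: "(W, \<psi>) \<in> \<A>"
    have "smooth_on (\<psi> ` (W \<inter> V)) (\<phi> \<circ> inv_into W \<psi>)"
      using man W V(1) unfolding smooth_manifold_def by blast
    then have "Ck_on k (\<psi> ` (W \<inter> V)) (\<lambda>a. \<phi> (inv_into W \<psi> a))"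
      by (simp add: smooth_on_def comp_def)
    then show "Ck_on k (\<psi> ` (W \<inter> V)) (\<lambda>a. F (\<phi> (inv_into W \<psi> a)))"
      by (intro Ck_on_compose[OF B open_charts_image[OF oc W oV], where T = UNIV] F_smooth) auto
  qed
  then have "smooth_fun \<A> V \<beta>"
    by (rule smooth_fun_cong[OF oc oV, rotated]) (auto simp: \<beta>_def K_iff intro: F_zero)
  moreover have "smooth_fun \<A> (- K) \<beta>"
    by (rule smooth_fun_cong[OF oc _ _ smooth_fun_const[OF oc, of _ 0]])
      (use \<open>closed K\<close> in \<open>auto simp: \<beta>_def\<close>)
  ultimately have "smooth_fun \<A> (V \<union> - K) \<beta>"
    using \<open>closed K\<close> oV by (intro smooth_fun_Un[OF oc]) auto
  moreover have "V \<union> - K = UNIV"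
    using sub by (auto simp: K_def intro: inv_into_into)
  moreover have "\<beta> p = 1"
    using K_iff[OF V(2)] r(1) by (simp add: \<beta>_def F_def flat_def flip: c_def)
  ultimately show thesis
    using that[of \<beta> K] \<open>closed K\<close> \<open>K \<subseteq> U\<close> by (simp add: \<beta>_def)
qed

text \<open>\<open>W\<close> is covered by the open sets \<open>U \<inter> W\<close> and
  \<open>W - K\<close>, and on the second the function is 0. With \<open>W = UNIV\<close> this makes
  local coefficients global; with \<open>W\<close> the domain of a second frame it gives the
  coefficients of a cut-off frame vector.\<close>

lemma smooth_fun_extend:
  assumes oc: "open_charts \<A>" and "open U" "open W" "closed K" "K \<subseteq> U"
    and "smooth_fun \<A> UNIV \<beta>" "\<And>x. x \<notin> K \<Longrightarrow> \<beta> x = 0" "smooth_fun \<A> (U \<inter> W) g"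
  shows "smooth_fun \<A> W (\<lambda>x. if x \<in> U then \<beta> x * g x else 0)"
proof -
  have "smooth_fun \<A> (U \<inter> W) (\<lambda>x. \<beta> x * g x)"
    using assms by (intro smooth_fun_mult smooth_fun_subset[OF assms(6)]) auto
  then have "smooth_fun \<A> (U \<inter> W) (\<lambda>x. if x \<in> U then \<beta> x * g x else 0)"
    by (rule smooth_fun_cong[OF oc, rotated 2]) (use assms in auto)
  moreover have "smooth_fun \<A> (W - K) (\<lambda>x. if x \<in> U then \<beta> x * g x else 0)"
    by (rule smooth_fun_cong[OF oc _ _ smooth_fun_const[OF oc, of _ 0]]) (use assms in auto)
  ultimately have "smooth_fun \<A> (U \<inter> W \<union> (W - K)) (\<lambda>x. if x \<in> U then \<beta> x * g x else 0)"
    using assms by (intro smooth_fun_Un[OF oc]) auto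
  moreover have "U \<inter> W \<union> (W - K) = W" using assms(5) by auto
  ultimately show ?thesis by simp
qed


section \<open>Products of generators\<close>

text \<open>Polarization of the relation v \<and> v = 0 at v + w.\<close>

lemma gen_anticommute: "gen v * gen w = - (gen w * gen (v::'v::real_vector))"
proof -
  have "gen v * gen w + gen w * gen v = gen (v + w) * gen (v + w) - gen v * gen v - gen w * gen w"
    by (simp add: gen_add algebra_simps)
  then have "gen v * gen w + gen w * gen v = 0"
    by (simp add: gen_square)
  then show ?thesis by (rule eq_neg_iff_add_eq_0[THEN iffD2])
qed

abbreviation gens :: "(nat \<Rightarrow> 'v::real_vector) \<Rightarrow> nat list \<Rightarrow> 'v ext" where
  "gens g is \<equiv> prod_list (map (\<lambda>i. gen (g i)) is)"

lemma gen_mult_gens: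
  "gen v * gens g is = (- 1) ^ length is *\<^sub>R (gens g is * gen v)"
proof (induction "is")
  case (Cons i "is")
  have "gen v * gens g (i # is) = - (gen (g i) * (gen v * gens g is))"
    by (simp add: gen_anticommute[of v "g i"] flip: mult.assoc)
  then show ?case by (simp add: Cons.IH mult.assoc)
qed simp

lemma gen_sum: "gen (\<Sum>i\<in>F. f i) = (\<Sum>i\<in>F. gen (f i))"
  using gen_scaleR[of 0 0] by (induction F rule: infinite_finite_induct) (auto simp: gen_add)

lemma gens_commute:
  "gens g is * gens h js = (- 1) ^ (length is * length js) *\<^sub>R (gens h js * gens g is)"
proof (induction "is")
  case (Cons i "is")
  have "gens g (i # is) * gens h js = gen (g i) * (gens g is * gens h js)"
    by (simp add: mult.assoc)
  also have "\<dots> = (- 1) ^ (length is * length js) *\<^sub>R (gen (g i) * gens h js * gens g is)"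
    by (simp add: Cons.IH mult.assoc)
  finally show ?case by (simp add: gen_mult_gens mult.assoc power_add)
qed simp

section \<open>Homogeneous components and products of ordered wedges\<close>

lemma ext_part_scaleR: "ext_part k (r *\<^sub>R a) = r *\<^sub>R ext_part k a"
  by transfer (simp add: scaleR_conv_of_real)

lemma ext_part_zero: "ext_part k 0 = 0"
  using ext_part_scaleR[of k 0 0] by simp

lemma ext_part_one: "ext_part k 1 = (if k = 0 then 1 else 0)"
  by transfer simp

lemma ext_part_sum: "ext_part k (\<Sum>i\<in>I. f i) = (\<Sum>i\<in>I. ext_part k (f i))"
  by (induction I rule: infinite_finite_induct) (auto simp: ext_part_add ext_part_zero)

lemma ext_part_gens: "ext_part k (gens g is) = (if k = length is then gens g is else 0)"
proof (induction "is" arbitrary: k)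
  case Nil
  then show ?case by (simp add: ext_part_one)
next
  case (Cons i "is")
  have "ext_part k (gens g (i # is)) = (\<Sum>j\<le>k. if j = 1 then gen (g i) * ext_part (k - 1) (gens g is) else 0)"
    by (simp add: ext_part_mult ext_part_gen if_distrib[of "\<lambda>x. x * _"] cong: if_cong)
  also have "\<dots> = (if 1 \<le> k then gen (g i) * ext_part (k - 1) (gens g is) else 0)"
    by (simp add: sum.delta)
  finally show ?case by (auto simp: Cons.IH)
qed

text \<open>Each smaller generator that is passed costs a sign, and meeting an equal one gives 0.
  The factor \<open>s\<close> is chosen before \<open>g\<close>: it depends on the indices alone, so
  for a frame evaluated at varying points it is a constant.\<close>

lemma gen_mult_gens_insort:
  assumes "sorted is" "distinct is"
  shows "\<exists>s::real. (i \<in> set is \<longrightarrow> s = 0) \<and> (\<forall>g::nat \<Rightarrow> 'v::real_vector. gen (g i) * gens g is = s *\<^sub>R gens g (insort i is))"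
  using assms
proof (induction "is")
  case Nil
  show ?case by (intro exI[of _ 1]) simp
next
  case (Cons a "is")
  consider "i < a" | "i = a" | "a < i" by linarith
  then show ?case
  proof cases
    case 1
    then have "i \<notin> set (a # is)" using Cons.prems(1) by auto
    then show ?thesis using 1 by (intro exI[of _ 1]) simp
  next
    case 2
    then show ?thesis by (intro exI[of _ 0]) (simp add: gen_square flip: mult.assoc)
  next
    case 3
    obtain s where s: "i \<in> set is \<longrightarrow> s = 0"
      "\<And>g::nat \<Rightarrow> 'v. gen (g i) * gens g is = s *\<^sub>R gens g (insort i is)"
      using Cons by auto
    have "gen (g i) * gens g (a # is) = (- s) *\<^sub>R gens g (insort i (a # is))" for g :: "nat \<Rightarrow> 'v"
    proof -
      have "gen (g i) * gens g (a # is) = - (gen (g a) * (gen (g i) * gens g is))"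
        by (simp add: gen_anticommute[of "g i" "g a"] flip: mult.assoc)
      then show ?thesis using 3 by (simp add: s(2))
    qed
    then show ?thesis using s(1) 3 by (intro exI[of _ "- s"]) auto
  qed
qed

lemma gens_mult_wedge_frame:
  assumes "finite J" "distinct is"
  shows "\<exists>s::real. (set is \<inter> J \<noteq> {} \<longrightarrow> s = 0) \<and>
    (\<forall>e x. gens (\<lambda>i. e i x) is * wedge_frame e J x = s *\<^sub>R wedge_frame (e :: nat \<Rightarrow> 'm \<Rightarrow> 'v::real_vector) (set is \<union> J) x)"
  using assms(2)
proof (induction "is")
  case Nil
  show ?case by (intro exI[of _ 1]) simp
next
  case (Cons i "is")
  then obtain s where s: "set is \<inter> J \<noteq> {} \<longrightarrow> s = 0"
    "\<And>e x. gens (\<lambda>i. e i x) is * wedge_frame e J x = s *\<^sub>R wedge_frame (e :: nat \<Rightarrow> 'm \<Rightarrow> 'v) (set is \<union> J) x"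
    by auto
  let ?K = "set is \<union> J"
  have fin: "finite ?K" using assms(1) by simp
  obtain s' where s': "i \<in> ?K \<longrightarrow> s' = 0"
    "\<And>g::nat \<Rightarrow> 'v. gen (g i) * gens g (sorted_list_of_set ?K) = s' *\<^sub>R gens g (insort i (sorted_list_of_set ?K))"
    using gen_mult_gens_insort[of "sorted_list_of_set ?K" i, where 'v = 'v] fin by auto
  have "gen (e i x) * wedge_frame e ?K x = s' *\<^sub>R wedge_frame e (insert i ?K) x" for e :: "nat \<Rightarrow> 'm \<Rightarrow> 'v" and x
  proof (cases "i \<in> ?K")
    case True
    then show ?thesis using s'(1) s'(2)[of "\<lambda>i. e i x"] by (simp add: wedge_frame_def)
  next
    case False
    then show ?thesis
      using s'(2)[of "\<lambda>i. e i x"] fin by (simp add: wedge_frame_def sorted_list_of_set_insert)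
  qed
  then have "gens (\<lambda>i. e i x) (i # is) * wedge_frame e J x = (s * s') *\<^sub>R wedge_frame e (set (i # is) \<union> J) x"
    for e :: "nat \<Rightarrow> 'm \<Rightarrow> 'v" and x
    by (simp add: mult.assoc s(2))
  moreover have "set (i # is) \<inter> J \<noteq> {} \<longrightarrow> s * s' = 0"
    using s(1) s'(1) by auto
  ultimately show ?case by (intro exI[of _ "s * s'"]) blast
qed

text \<open>Since \<open>s\<close> does not depend on \<open>x\<close>, the coefficients of a
  product of smooth multisections in a frame remain smooth.\<close>

lemma wedge_frame_mult:
  fixes e :: "nat \<Rightarrow> 'm \<Rightarrow> 'v::real_vector"
  assumes "finite I" "finite J"
  obtains s :: real where "I \<inter> J \<noteq> {} \<Longrightarrow> s = 0"
    "\<And>x. wedge_frame e I x * wedge_frame e J x = s *\<^sub>R wedge_frame e (I \<union> J) x"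
  using gens_mult_wedge_frame[OF assms(2) distinct_sorted_list_of_set[of I], where 'v = 'v and 'm = 'm] assms(1)
  by (force simp: wedge_frame_def)


section \<open>Multisections\<close>

text \<open>The condition that membership in \<open>msections\<close> imposes on a single frame,
  isolated so that closure properties can be proved one frame at a time.\<close>

definition frame_span ::
  "('m, 'e::real_inner) atlas \<Rightarrow> nat \<Rightarrow> 'm set \<Rightarrow> (nat \<Rightarrow> 'm \<Rightarrow> 'v::real_vector) \<Rightarrow> int \<Rightarrow> ('m \<Rightarrow> 'v ext) set" where
  "frame_span \<A> n U e k =
     {X. \<exists>c :: nat set \<Rightarrow> 'm \<Rightarrow> real.
           (\<forall>I. I \<subseteq> {..<n} \<and> int (card I) = k \<longrightarrow> smooth_fun \<A> U (c I)) \<and>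
           (\<forall>x\<in>U. X x = (\<Sum>I | I \<subseteq> {..<n} \<and> int (card I) = k. c I x *\<^sub>R wedge_frame e I x))}"

lemma frame_spanE:
  assumes "X \<in> frame_span \<A> n U e k"
  obtains c where "\<And>I. I \<subseteq> {..<n} \<and> int (card I) = k \<Longrightarrow> smooth_fun \<A> U (c I)"
    "\<And>x. x \<in> U \<Longrightarrow> X x = (\<Sum>I | I \<subseteq> {..<n} \<and> int (card I) = k. c I x *\<^sub>R wedge_frame e I x)"
proof -
  from assms obtain c where "(\<forall>I. I \<subseteq> {..<n} \<and> int (card I) = k \<longrightarrow> smooth_fun \<A> U (c I)) \<and>
    (\<forall>x\<in>U. X x = (\<Sum>I | I \<subseteq> {..<n} \<and> int (card I) = k. c I x *\<^sub>R wedge_frame e I x))"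
    unfolding frame_span_def mem_Collect_eq by (elim exE)
  then show thesis by (intro that[of c]) simp_all
qed

lemma msections_iff: "X \<in> msections \<A> E k \<longleftrightarrow> (\<forall>(U, e)\<in>frames E. X \<in> frame_span \<A> (rank E) U e k)"
  by (simp add: msections_def frame_span_def)

lemma finite_index_sets [simp]: "finite {I. I \<subseteq> {..<n::nat} \<and> int (card I) = k}"
  by (rule finite_subset[of _ "Pow {..<n}"]) auto

lemma frame_span_cong: "X \<in> frame_span \<A> n U e k \<Longrightarrow> (\<And>x. x \<in> U \<Longrightarrow> X x = Y x) \<Longrightarrow> Y \<in> frame_span \<A> n U e k"
  by (auto simp: frame_span_def)

lemma wedge_frame_singleton: "wedge_frame e {i} x = gen (e i x)"
  by (simp add: wedge_frame_def)

context
  fixes \<A> :: "('m::topological_space, 'e::real_inner) atlas" and U :: "'m set"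
  assumes oc: "open_charts \<A>" and oU: "open U"
begin

lemma frame_span_base:
  assumes "I \<subseteq> {..<n}" "int (card I) = k" "smooth_fun \<A> U c"
  shows "(\<lambda>x. c x *\<^sub>R wedge_frame e I x) \<in> frame_span \<A> n U e k"
proof -
  have "c x *\<^sub>R wedge_frame e I x
      = (\<Sum>J | J \<subseteq> {..<n} \<and> int (card J) = k. (if J = I then c else (\<lambda>x. 0)) x *\<^sub>R wedge_frame e J x)" for x
  proof -
    have "(\<Sum>J | J \<subseteq> {..<n} \<and> int (card J) = k. (if J = I then c else (\<lambda>x. 0)) x *\<^sub>R wedge_frame e J x)
      = (\<Sum>J | J \<subseteq> {..<n} \<and> int (card J) = k. if J = I then c x *\<^sub>R wedge_frame e J x else 0)"
      by (intro sum.cong) auto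
    also have "\<dots> = c x *\<^sub>R wedge_frame e I x"
      using assms(1,2) by (simp add: sum.delta)
    finally show ?thesis by simp
  qed
  note 1 = this
  have "smooth_fun \<A> U (if J = I then c else (\<lambda>x. 0))" for J
    using assms(3) smooth_fun_const[OF oc oU] by simp
  then show ?thesis
    unfolding frame_span_def
    by (intro CollectI exI[of _ "\<lambda>J. if J = I then c else (\<lambda>x. 0)"] conjI allI impI ballI 1)
qed

lemma frame_span_add:
  assumes "X \<in> frame_span \<A> n U e k" "Y \<in> frame_span \<A> n U e k"
  shows "(\<lambda>x. X x + Y x) \<in> frame_span \<A> n U e k"
proof -
  obtain c where c: "\<And>I. I \<subseteq> {..<n} \<and> int (card I) = k \<Longrightarrow> smooth_fun \<A> U (c I)"
      "\<And>x. x \<in> U \<Longrightarrow> X x = (\<Sum>I | I \<subseteq> {..<n} \<and> int (card I) = k. c I x *\<^sub>R wedge_frame e I x)"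
    by (rule frame_spanE[OF assms(1)]) (rule that; simp)
  obtain d where d: "\<And>I. I \<subseteq> {..<n} \<and> int (card I) = k \<Longrightarrow> smooth_fun \<A> U (d I)"
      "\<And>x. x \<in> U \<Longrightarrow> Y x = (\<Sum>I | I \<subseteq> {..<n} \<and> int (card I) = k. d I x *\<^sub>R wedge_frame e I x)"
    by (rule frame_spanE[OF assms(2)]) (rule that; simp)
  show ?thesis
    unfolding frame_span_def
    by (intro CollectI exI[of _ "\<lambda>I x. c I x + d I x"] conjI allI impI ballI smooth_fun_add[OF oc oU])
      (auto simp: c d scaleR_add_left sum.distrib)
qed

lemma frame_span_zero: "(\<lambda>x. 0) \<in> frame_span \<A> n U e k"
  unfolding frame_span_def
  by (intro CollectI exI[of _ "\<lambda>I x. 0"] conjI) (auto intro: smooth_fun_const[OF oc oU])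

lemma frame_span_sum:
  "(\<And>i. i \<in> F \<Longrightarrow> X i \<in> frame_span \<A> n U e k) \<Longrightarrow> (\<lambda>x. \<Sum>i\<in>F. X i x) \<in> frame_span \<A> n U e k"
  by (induction F rule: infinite_finite_induct) (auto intro: frame_span_add frame_span_zero)

lemma frame_span_scale:
  assumes "X \<in> frame_span \<A> n U e k" "smooth_fun \<A> U f"
  shows "(\<lambda>x. f x *\<^sub>R X x) \<in> frame_span \<A> n U e k"
proof -
  obtain c where c: "\<And>I. I \<subseteq> {..<n} \<and> int (card I) = k \<Longrightarrow> smooth_fun \<A> U (c I)"
      "\<And>x. x \<in> U \<Longrightarrow> X x = (\<Sum>I | I \<subseteq> {..<n} \<and> int (card I) = k. c I x *\<^sub>R wedge_frame e I x)"
    by (rule frame_spanE[OF assms(1)]) (rule that; simp)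
  show ?thesis
    unfolding frame_span_def
    by (intro CollectI exI[of _ "\<lambda>I x. f x * c I x"] conjI allI impI ballI smooth_fun_mult[OF oc oU])
      (auto simp: c assms(2) scaleR_sum_right)
qed

lemma frame_span_wedge:
  assumes "X \<in> frame_span \<A> n U e k" "Y \<in> frame_span \<A> n U e l"
  shows "wedge X Y \<in> frame_span \<A> n U e (k + l)"
proof -
  obtain c where c: "\<And>I. I \<subseteq> {..<n} \<and> int (card I) = k \<Longrightarrow> smooth_fun \<A> U (c I)"
      "\<And>x. x \<in> U \<Longrightarrow> X x = (\<Sum>I | I \<subseteq> {..<n} \<and> int (card I) = k. c I x *\<^sub>R wedge_frame e I x)"
    by (rule frame_spanE[OF assms(1)]) (rule that; simp)
  obtain d where d: "\<And>I. I \<subseteq> {..<n} \<and> int (card I) = l \<Longrightarrow> smooth_fun \<A> U (d I)"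
      "\<And>x. x \<in> U \<Longrightarrow> Y x = (\<Sum>I | I \<subseteq> {..<n} \<and> int (card I) = l. d I x *\<^sub>R wedge_frame e I x)"
    by (rule frame_spanE[OF assms(2)]) (rule that; simp)
  have "(\<lambda>x. \<Sum>I | I \<subseteq> {..<n} \<and> int (card I) = k. \<Sum>J | J \<subseteq> {..<n} \<and> int (card J) = l.
      (c I x * d J x) *\<^sub>R (wedge_frame e I x * wedge_frame e J x)) \<in> frame_span \<A> n U e (k + l)"
  proof (intro frame_span_sum)
    fix I J assume "I \<in> {I. I \<subseteq> {..<n} \<and> int (card I) = k}" "J \<in> {I. I \<subseteq> {..<n} \<and> int (card I) = l}"
    then have IJ: "I \<subseteq> {..<n}" "int (card I) = k" "J \<subseteq> {..<n}" "int (card J) = l" by auto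
    then have fin: "finite I" "finite J" by (auto intro: finite_subset)
    obtain s where s: "I \<inter> J \<noteq> {} \<Longrightarrow> s = 0"
      "\<And>x. wedge_frame e I x * wedge_frame e J x = s *\<^sub>R wedge_frame e (I \<union> J) x"
      using wedge_frame_mult[OF fin, of e] by metis
    have sm: "smooth_fun \<A> U (\<lambda>x. c I x * d J x)"
      using IJ by (intro smooth_fun_mult[OF oc oU] c d) auto
    show "(\<lambda>x. (c I x * d J x) *\<^sub>R (wedge_frame e I x * wedge_frame e J x)) \<in> frame_span \<A> n U e (k + l)"
    proof (cases "I \<inter> J = {}")
      case True
      then have "int (card (I \<union> J)) = k + l" using IJ fin by (simp add: card_Un_disjoint)
      then show ?thesis
        unfolding s(2) scaleR_scaleR
        using IJ by (intro frame_span_base smooth_fun_mult[OF oc oU] sm smooth_fun_const[OF oc oU]) auto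
    qed (simp add: s frame_span_zero)
  qed
  then show ?thesis
    by (rule frame_span_cong)
      (simp add: wedge_def c(2) d(2) sum_product mult.commute)
qed

lemma frame_span_of_sec:
  assumes "\<And>i. i < n \<Longrightarrow> smooth_fun \<A> U (c i)" "\<And>x. x \<in> U \<Longrightarrow> s x = (\<Sum>i<n. c i x *\<^sub>R e i x)"
  shows "of_sec s \<in> frame_span \<A> n U e 1"
proof -
  have "(\<lambda>x. \<Sum>i<n. c i x *\<^sub>R wedge_frame e {i} x) \<in> frame_span \<A> n U e 1"
    by (intro frame_span_sum frame_span_base) (auto simp: assms)
  then show ?thesis
    by (rule frame_span_cong) (simp add: of_sec_def assms gen_sum gen_scaleR wedge_frame_singleton)
qed

lemma frame_span_of_fun:
  assumes "smooth_fun \<A> U f"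
  shows "of_fun f \<in> frame_span \<A> n U e 0"
  by (rule frame_span_cong[OF frame_span_base[of "{}" n 0 f]])
    (auto simp: assms wedge_frame_def of_fun_def of_real_def)

end

lemma frame_span_ext_part:
  assumes "X \<in> frame_span \<A> n U e k" "x \<in> U"
  shows "ext_part j (X x) = (if int j = k then X x else 0)"
proof -
  obtain c where "\<And>x. x \<in> U \<Longrightarrow> X x = (\<Sum>I | I \<subseteq> {..<n} \<and> int (card I) = k. c I x *\<^sub>R wedge_frame e I x)"
    by (rule frame_spanE[OF assms(1)]) (rule that; simp)
  then have "X x = (\<Sum>I | I \<subseteq> {..<n} \<and> int (card I) = k. c I x *\<^sub>R wedge_frame e I x)"
    using assms(2) .
  moreover have "ext_part j (wedge_frame e I x) = (if j = card I then wedge_frame e I x else 0)" for I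
    by (simp add: wedge_frame_def ext_part_gens)
  ultimately show ?thesis
    by (auto simp: ext_part_sum ext_part_scaleR intro!: sum.cong sum.neutral)
qed

lemma frame_span_commute:
  assumes "X \<in> frame_span \<A> n U e k" "Y \<in> frame_span \<A> n U e l" "x \<in> U"
  shows "X x * Y x = ((- 1) powi (k * l)) *\<^sub>R (Y x * X x)"
proof -
  obtain c where "\<And>x. x \<in> U \<Longrightarrow> X x = (\<Sum>I | I \<subseteq> {..<n} \<and> int (card I) = k. c I x *\<^sub>R wedge_frame e I x)"
    by (rule frame_spanE[OF assms(1)]) (rule that; simp)
  note c = this[OF assms(3)]
  obtain d where "\<And>x. x \<in> U \<Longrightarrow> Y x = (\<Sum>I | I \<subseteq> {..<n} \<and> int (card I) = l. d I x *\<^sub>R wedge_frame e I x)"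
    by (rule frame_spanE[OF assms(2)]) (rule that; simp)
  note d = this[OF assms(3)]
  have "wedge_frame e I x * wedge_frame e J x = ((- 1) powi (k * l)) *\<^sub>R (wedge_frame e J x * wedge_frame e I x)"
    if "int (card I) = k" "int (card J) = l" for I J
  proof -
    have "k * l = int (card I * card J)" using that by simp
    then show ?thesis
      unfolding wedge_frame_def by (subst gens_commute) (simp del: of_nat_mult)
  qed
  then have "X x * Y x = (\<Sum>I | I \<subseteq> {..<n} \<and> int (card I) = k. \<Sum>J | J \<subseteq> {..<n} \<and> int (card J) = l.
     ((- 1) powi (k * l)) *\<^sub>R (d J x *\<^sub>R wedge_frame e J x * c I x *\<^sub>R wedge_frame e I x))"
    by (auto simp: c d sum_product mult.commute intro!: sum.cong)
  also have "\<dots> = ((- 1) powi (k * l)) *\<^sub>R (Y x * X x)"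
    unfolding c d sum_product scaleR_sum_right by (rule sum.swap)
  finally show ?thesis .
qed

lemma frame_span_trivial:
  assumes "X \<in> frame_span \<A> n U e k" "x \<in> U" "k < 0 \<or> int n < k"
  shows "X x = 0"
proof -
  have "\<not> (I \<subseteq> {..<n} \<and> int (card I) = k)" for I
  proof
    assume I: "I \<subseteq> {..<n} \<and> int (card I) = k"
    then have "card I \<le> n" using card_mono[OF finite_lessThan, of I n] by simp
    with I assms(3) show False by linarith
  qed
  then have "{I. I \<subseteq> {..<n} \<and> int (card I) = k} = {}" by (simp only: empty_Collect_eq) simp
  moreover obtain c where "\<And>x. x \<in> U \<Longrightarrow> X x = (\<Sum>I | I \<subseteq> {..<n} \<and> int (card I) = k. c I x *\<^sub>R wedge_frame e I x)"
    by (rule frame_spanE[OF assms(1)]) (rule that; simp)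
  ultimately show ?thesis using assms(2) by (simp only: sum.empty)
qed


section \<open>Multisections of a vector bundle\<close>

lemma frame_open: "vector_bundle \<A> E \<Longrightarrow> (U, e) \<in> frames E \<Longrightarrow> open U"
  by (auto simp: vector_bundle_def)

lemma frame_cover:
  assumes "vector_bundle \<A> E"
  obtains U e where "(U, e) \<in> frames E" "x \<in> U"
proof -
  have "x \<in> (\<Union>(U, e)\<in>frames E. U)" using assms by (simp add: vector_bundle_def)
  then show thesis using that by auto
qed

lemma fibre_span:
  "vector_bundle \<A> E \<Longrightarrow> (U, e) \<in> frames E \<Longrightarrow> x \<in> U \<Longrightarrow> fibre E x = span ((\<lambda>i. e i x) ` {..<rank E})"
  by (auto simp: vector_bundle_def)

lemma frame_transition:
  fixes \<A> :: "('m::topological_space, 'e::real_inner) atlas" and E :: "('m, 'v::real_vector) vbundle"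
  assumes "vector_bundle \<A> E" "(U, e) \<in> frames E" "(V, e') \<in> frames E"
  shows "\<exists>g :: nat \<Rightarrow> nat \<Rightarrow> 'm \<Rightarrow> real.
        (\<forall>i<rank E. \<forall>j<rank E. smooth_fun \<A> (U \<inter> V) (g i j)) \<and>
        (\<forall>x\<in>U \<inter> V. \<forall>j<rank E. e' j x = (\<Sum>i<rank E. g i j x *\<^sub>R e i x))"
proof -
  have "\<forall>(U, e)\<in>frames E. \<forall>(V, e')\<in>frames E. \<exists>g :: nat \<Rightarrow> nat \<Rightarrow> 'm \<Rightarrow> real.
        (\<forall>i<rank E. \<forall>j<rank E. smooth_fun \<A> (U \<inter> V) (g i j)) \<and>
        (\<forall>x\<in>U \<inter> V. \<forall>j<rank E. e' j x = (\<Sum>i<rank E. g i j x *\<^sub>R e i x))"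
    using assms(1) unfolding vector_bundle_def by (elim conjE)
  from bspec[OF bspec[OF this assms(2), unfolded prod.case] assms(3), unfolded prod.case]
  show ?thesis .
qed

lemma zero_in_fibre: "vector_bundle \<A> E \<Longrightarrow> 0 \<in> fibre E x"
  using frame_cover[of \<A> E x] fibre_span span_zero by metis

lemma Cinf_const: "open_charts \<A> \<Longrightarrow> (\<lambda>x. c) \<in> Cinf \<A>"
  by (simp add: smooth_fun_const)

context
  fixes \<A> :: "('m::topological_space, 'e::real_inner) atlas" and E :: "('m, 'v::real_vector) vbundle"
  assumes oc: "open_charts \<A>" and vb: "vector_bundle \<A> E"
begin

lemma msections_zero: "(\<lambda>x. 0) \<in> msections \<A> E k"
  unfolding msections_iff by (auto intro: frame_span_zero[OF oc] frame_open[OF vb])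

lemma msections_add: "X \<in> msections \<A> E k \<Longrightarrow> Y \<in> msections \<A> E k \<Longrightarrow> (\<lambda>x. X x + Y x) \<in> msections \<A> E k"
  unfolding msections_iff by (auto intro!: frame_span_add[OF oc] frame_open[OF vb])

lemma msections_scale:
  assumes "X \<in> msections \<A> E k" "f \<in> Cinf \<A>"
  shows "(\<lambda>x. f x *\<^sub>R X x) \<in> msections \<A> E k"
proof -
  have "smooth_fun \<A> U f" for U using assms(2) smooth_fun_subset[of \<A> UNIV f U] by simp
  then show ?thesis
    using assms(1) unfolding msections_iff by (auto intro!: frame_span_scale[OF oc] frame_open[OF vb])
qed

lemma msections_scaleR: "X \<in> msections \<A> E k \<Longrightarrow> (\<lambda>x. r *\<^sub>R X x) \<in> msections \<A> E k"
  by (rule msections_scale[OF _ Cinf_const[OF oc]])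

lemma msections_wedge:
  "X \<in> msections \<A> E k \<Longrightarrow> Y \<in> msections \<A> E l \<Longrightarrow> wedge X Y \<in> msections \<A> E (k + l)"
  unfolding msections_iff by (auto intro!: frame_span_wedge[OF oc] frame_open[OF vb])

lemma msections_of_fun:
  assumes "f \<in> Cinf \<A>"
  shows "of_fun f \<in> msections \<A> E 0"
proof -
  have "smooth_fun \<A> U f" for U using assms smooth_fun_subset[of \<A> UNIV f U] by simp
  then show ?thesis
    unfolding msections_iff by (auto intro!: frame_span_of_fun[OF oc] frame_open[OF vb])
qed

lemma msections_of_sec:
  assumes "s \<in> sections \<A> E"
  shows "of_sec s \<in> msections \<A> E 1"
  unfolding msections_iff
proof (clarify)
  fix U e assume U: "(U, e) \<in> frames E"
  then have "\<exists>c :: nat \<Rightarrow> 'm \<Rightarrow> real. (\<forall>i<rank E. smooth_fun \<A> U (c i)) \<and>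
      (\<forall>x\<in>U. s x = (\<Sum>i<rank E. c i x *\<^sub>R e i x))"
    using assms unfolding sections_def mem_Collect_eq by blast
  then obtain c where "\<forall>i<rank E. smooth_fun \<A> U (c i)"
    "\<forall>x\<in>U. s x = (\<Sum>i<rank E. c i x *\<^sub>R e i x)" by (elim exE conjE)
  then show "of_sec s \<in> frame_span \<A> (rank E) U e 1"
    by (intro frame_span_of_sec[OF oc frame_open[OF vb U], of _ c]) simp_all
qed

lemma msections_commute:
  assumes "X \<in> msections \<A> E k" "Y \<in> msections \<A> E l"
  shows "X x * Y x = ((- 1) powi (k * l)) *\<^sub>R (Y x * X x)"
proof -
  obtain U e where U: "(U, e) \<in> frames E" "x \<in> U" by (rule frame_cover[OF vb])
  then show ?thesis
    using assms frame_span_commute[of X \<A> "rank E" U e k Y l x] unfolding msections_iff by blast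
qed

lemma msections_trivial:
  assumes "X \<in> msections \<A> E k" "k < 0 \<or> int (rank E) < k"
  shows "X = (\<lambda>x. 0)"
proof
  fix x
  obtain U e where U: "(U, e) \<in> frames E" "x \<in> U" by (rule frame_cover[OF vb])
  then show "X x = 0"
    using assms frame_span_trivial[of X \<A> "rank E" U e k x] unfolding msections_iff by blast
qed

lemma msections_part:
  assumes "X \<in> msections \<A> E k"
  shows "part j X = (if int j = k then X else (\<lambda>x. 0))"
proof
  fix x
  obtain U e where U: "(U, e) \<in> frames E" "x \<in> U" by (rule frame_cover[OF vb])
  then have "X \<in> frame_span \<A> (rank E) U e k" using assms unfolding msections_iff by blast
  then show "part j X x = (if int j = k then X else (\<lambda>x. 0)) x"
    using frame_span_ext_part[of X \<A> "rank E" U e k x j] U(2) by (simp add: part_def)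
qed

text \<open>Linearity of the bracket and of the contraction is postulated on
  \<open>all_msections\<close>; this makes it available for homogeneous elements. Degrees outside
  the range of the sum contain only 0.\<close>

lemma msections_all:
  assumes "X \<in> msections \<A> E k"
  shows "X \<in> all_msections \<A> E"
proof (cases "k < 0 \<or> int (rank E) < k")
  case True
  then have "X = (\<lambda>x. \<Sum>j\<le>rank E. (\<lambda>x. 0) x)" using msections_trivial[OF assms] by simp
  then show ?thesis
    unfolding all_msections_def
    by (intro CollectI exI[of _ "\<lambda>j x. 0"]) (auto intro: msections_zero)
next
  case False
  then obtain n where n: "k = int n" "n \<le> rank E" by (metis int_ops(1) nat_int_comparison(3) nonneg_int_cases not_less)
  have "X = (\<lambda>x. \<Sum>j\<le>rank E. (if j = n then X else (\<lambda>x. 0)) x)"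
  proof
    fix x
    have "(\<Sum>j\<le>rank E. (if j = n then X else (\<lambda>x. 0)) x) = (\<Sum>j\<le>rank E. if j = n then X x else 0)"
      by (intro sum.cong) auto
    then show "X x = (\<Sum>j\<le>rank E. (if j = n then X else (\<lambda>x. 0)) x)" using n(2) by simp
  qed
  then show ?thesis
    unfolding all_msections_def using assms n
    by (intro CollectI exI[of _ "\<lambda>j. if j = n then X else (\<lambda>x. 0)"]) (auto intro: msections_zero)
qed

text \<open>Together with functions, these products generate multisections near a point. The list
  form permits an induction that splits off one section at a time by the Leibniz rule.\<close>

lemma msections_prod_list:
  "(\<And>s. s \<in> set ss \<Longrightarrow> s \<in> sections \<A> E) \<Longrightarrow>
    (\<lambda>x. prod_list (map (\<lambda>s. gen (s x)) ss)) \<in> msections \<A> E (int (length ss))"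
proof (induction ss)
  case Nil
  show ?case using msections_of_fun[OF Cinf_const[OF oc, of 1]] by (simp add: of_fun_def)
next
  case (Cons s ss)
  have "wedge (of_sec s) (\<lambda>x. prod_list (map (\<lambda>s. gen (s x)) ss)) \<in> msections \<A> E (1 + int (length ss))"
    using Cons by (intro msections_wedge msections_of_sec) auto
  then show ?case by (simp add: wedge_def of_sec_def)
qed

text \<open>In any other frame the coefficients are the cutoff times the transition functions, which
  are smooth on the overlap and are extended by 0.\<close>

lemma section_extend:
  assumes U: "(U, e) \<in> frames E" "i < rank E"
    and K: "closed K" "K \<subseteq> U" "smooth_fun \<A> UNIV \<beta>" "\<And>x. x \<notin> K \<Longrightarrow> \<beta> x = 0"
  shows "(\<lambda>x. if x \<in> U then \<beta> x *\<^sub>R e i x else 0) \<in> sections \<A> E"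
  unfolding sections_def
proof (intro CollectI conjI allI, goal_cases)
  case (1 x)
  show ?case
    using U(2) by (auto simp: zero_in_fibre[OF vb] fibre_span[OF vb U(1)] intro: span_scale span_base)
next
  case 2
  show ?case
  proof (clarify)
    fix V e' assume V: "(V, e') \<in> frames E"
    \<comment> \<open>The order of the frames matters: \<open>e\<close>, the frame being cut off, is
      expanded in \<open>e'\<close>.\<close>
    from frame_transition[OF vb V U(1)] obtain g :: "nat \<Rightarrow> nat \<Rightarrow> 'm \<Rightarrow> real" where
      g: "\<forall>i<rank E. \<forall>j<rank E. smooth_fun \<A> (V \<inter> U) (g i j)"
      "\<forall>x\<in>V \<inter> U. \<forall>j<rank E. e j x = (\<Sum>i<rank E. g i j x *\<^sub>R e' i x)"
      by (elim exE conjE)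
    define c where "c = (\<lambda>j x. if x \<in> U then \<beta> x * g j i x else 0)"
    have "smooth_fun \<A> V (c j)" if "j < rank E" for j
      unfolding c_def
      using g(1) that U(2)
      by (intro smooth_fun_extend[OF oc frame_open[OF vb U(1)] frame_open[OF vb V] K(1,2,3,4)])
        (auto simp: Int_commute)
    moreover have "(if x \<in> U then \<beta> x *\<^sub>R e i x else 0) = (\<Sum>j<rank E. c j x *\<^sub>R e' j x)" if "x \<in> V" for x
    proof (cases "x \<in> U")
      case True
      then have "e i x = (\<Sum>j<rank E. g j i x *\<^sub>R e' j x)" using g(2) that U(2) by blast
      then show ?thesis using True by (simp add: c_def scaleR_sum_right)
    qed (simp add: c_def)
    ultimately show "\<exists>c. (\<forall>j<rank E. smooth_fun \<A> V (c j)) \<and>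
      (\<forall>x\<in>V. (if x \<in> U then \<beta> x *\<^sub>R e i x else 0) = (\<Sum>j<rank E. c j x *\<^sub>R e' j x))"
      by (intro exI[of _ c]) simp
  qed
qed

end

section \<open>Derivations are determined by functions and sections\<close>

text \<open>With a bump function \<open>\<beta>\<close> around \<open>p\<close> in the domain of a frame, \<open>\<beta>\<^sup>k\<^sup>+\<^sup>1 X\<close> is a finite sum of products
  of globally defined functions and sections, while \<open>T (\<beta>\<^sup>k\<^sup>+\<^sup>1 X) = T X\<close>.\<close>

lemma point_derivation_eq_0:
  fixes \<A> :: "('m::{t2_space, second_countable_topology}, 'e::real_inner) atlas"
    and E :: "('m, 'v::real_vector) vbundle" and T :: "('m \<Rightarrow> 'v ext) \<Rightarrow> 'v ext"
  assumes man: "smooth_manifold \<A>" and vb: "vector_bundle \<A> E"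
    and lin: "\<And>k X Y a b. X \<in> msections \<A> E k \<Longrightarrow> Y \<in> msections \<A> E k \<Longrightarrow>
      T (\<lambda>x. a *\<^sub>R X x + b *\<^sub>R Y x) = a *\<^sub>R T X + b *\<^sub>R T Y"
    and leibniz: "\<And>k l X Y. X \<in> msections \<A> E k \<Longrightarrow> Y \<in> msections \<A> E l \<Longrightarrow>
      T (wedge X Y) = T X * Y p + \<sigma> k *\<^sub>R (X p * T Y)"
    and \<sigma>: "\<sigma> 0 = 1"
    and on_fun: "\<And>f. f \<in> Cinf \<A> \<Longrightarrow> T (of_fun f) = 0"
    and on_sec: "\<And>s. s \<in> sections \<A> E \<Longrightarrow> T (of_sec s) = 0"
    and X: "X \<in> msections \<A> E k"
  shows "T X = 0"
proof (cases "k < 0")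
  case True
  \<comment> \<open>There are no nonzero elements of negative degree, so \<open>X\<close> is its own
    trivial combination, and linearity turns this into \<open>T X = 0\<close>.\<close>
  then have "X = (\<lambda>x. 0 *\<^sub>R X x + 0 *\<^sub>R X x)"
    using msections_trivial[OF open_charts_manifold[OF man] vb X] by simp
  then have "T X = 0 *\<^sub>R T X + 0 *\<^sub>R T X" using lin[OF X X, of 0 0] by simp
  then show ?thesis by simp
next
  case False
  then obtain n where n: "k = int n" using nonneg_int_cases by (metis not_less)
  note oc = open_charts_manifold[OF man]
  obtain U e where U: "(U, e) \<in> frames E" "p \<in> U" by (rule frame_cover[OF vb])
  note oU = frame_open[OF vb U(1)]
  obtain \<beta> K where b: "smooth_fun \<A> UNIV \<beta>" "\<beta> p = 1" "closed K" "K \<subseteq> U" "\<And>x. x \<notin> K \<Longrightarrow> \<beta> x = 0"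
    using smooth_bump[OF man oU U(2)] by metis
  have "X \<in> frame_span \<A> (rank E) U e k" using X U(1) unfolding msections_iff by blast
  then obtain c where c: "\<And>I. I \<subseteq> {..<rank E} \<and> int (card I) = k \<Longrightarrow> smooth_fun \<A> U (c I)"
    "\<And>x. x \<in> U \<Longrightarrow> X x = (\<Sum>I | I \<subseteq> {..<rank E} \<and> int (card I) = k. c I x *\<^sub>R wedge_frame e I x)"
    by (rule frame_spanE) (rule that; simp)
  define s where "s = (\<lambda>i x. if x \<in> U then \<beta> x *\<^sub>R e i x else 0)"
  define f where "f = (\<lambda>I x. if x \<in> U then \<beta> x * c I x else 0)"
  have s: "s i \<in> sections \<A> E" if "i < rank E" for i
    unfolding s_def by (rule section_extend[OF oc vb U(1) that b(3,4,1,5)])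
  have f: "f I \<in> Cinf \<A>" if "I \<subseteq> {..<rank E} \<and> int (card I) = k" for I
    unfolding f_def using smooth_fun_extend[OF oc oU open_UNIV b(3,4,1,5)] c(1)[OF that] by simp
  have lists: "T (\<lambda>x. prod_list (map (\<lambda>s. gen (s x)) ss)) = 0"
    if "\<And>s. s \<in> set ss \<Longrightarrow> s \<in> sections \<A> E" for ss
    using that
  proof (induction ss)
    case Nil
    show ?case using on_fun[OF Cinf_const[OF oc, of 1]] by (simp add: of_fun_def)
  next
    case (Cons s ss)
    have "T (wedge (of_sec s) (\<lambda>x. prod_list (map (\<lambda>s. gen (s x)) ss))) = 0"
      using Cons
      by (subst leibniz[OF msections_of_sec[OF oc vb] msections_prod_list[OF oc vb]]) (auto simp: on_sec)
    then show ?case by (simp add: wedge_def of_sec_def)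
  qed
  \<comment> \<open>\<open>W I\<close> contains the cutoff once in \<open>f I\<close> and once in
    each of its \<open>n\<close> sections, which is where the exponent n + 1 below comes
    from.\<close>
  define W where "W = (\<lambda>I. wedge (of_fun (f I)) (\<lambda>x. prod_list (map (\<lambda>s. gen (s x)) (map s (sorted_list_of_set I)))))"
  have W: "W I \<in> msections \<A> E k \<and> T (W I) = 0" if I: "I \<subseteq> {..<rank E} \<and> int (card I) = k" for I
  proof -
    have fin: "finite I" using I by (auto intro: finite_subset)
    define L where "L = map s (sorted_list_of_set I)"
    have L: "s' \<in> sections \<A> E" if "s' \<in> set L" for s'
      using that s fin I by (auto simp: L_def)
    have "int (length L) = k" using I by (simp add: L_def)
    then have m: "(\<lambda>x. prod_list (map (\<lambda>s. gen (s x)) L)) \<in> msections \<A> E k"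
      using msections_prod_list[OF oc vb, of L] L by simp
    have "T (W I) = 0"
      unfolding W_def L_def[symmetric]
      by (subst leibniz[OF msections_of_fun[OF oc vb f[OF I]] m]) (simp add: lists[OF L] on_fun[OF f[OF I]])
    then show ?thesis
      using msections_wedge[OF oc vb msections_of_fun[OF oc vb f[OF I]] m] by (simp add: W_def L_def)
  qed
  \<comment> \<open>Membership is carried along because linearity of \<open>T\<close> is given only
    for multisections of a common degree.\<close>
  have sum: "(\<lambda>x. \<Sum>I\<in>F. W I x) \<in> msections \<A> E k \<and> T (\<lambda>x. \<Sum>I\<in>F. W I x) = 0"
    if "finite F" "F \<subseteq> {I. I \<subseteq> {..<rank E} \<and> int (card I) = k}" for F
    using that
  proof (induction F rule: finite_induct)
    case empty
    show ?case using msections_zero[OF oc vb] lin[OF X X, of 0 0] by simp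
  next
    case (insert I F)
    then show ?case
      using W[of I] lin[of "W I" k "\<lambda>x. \<Sum>I\<in>F. W I x" 1 1]
        msections_add[OF oc vb, of "W I" k "\<lambda>x. \<Sum>I\<in>F. W I x"] by simp
  qed
  have "wedge (of_fun (\<lambda>x. \<beta> x ^ (n + 1))) X
      = (\<lambda>x. \<Sum>I | I \<subseteq> {..<rank E} \<and> int (card I) = k. W I x)"
  proof
    fix x
    show "wedge (of_fun (\<lambda>x. \<beta> x ^ (n + 1))) X x
      = (\<Sum>I | I \<subseteq> {..<rank E} \<and> int (card I) = k. W I x)"
    proof (cases "x \<in> U")
      case True
      have prod: "prod_list (map (\<lambda>i. gen (\<beta> x *\<^sub>R e i x)) is) = \<beta> x ^ length is *\<^sub>R prod_list (map (\<lambda>i. gen (e i x)) is)" for "is"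
        by (induction "is") (simp_all add: gen_scaleR)
      have "W I x = \<beta> x ^ (n + 1) *\<^sub>R (c I x *\<^sub>R wedge_frame e I x)" if "int (card I) = k" for I
        using True that n
        by (simp add: W_def wedge_def of_fun_def f_def s_def wedge_frame_def comp_def prod
            flip: scaleR_conv_of_real)
      then show ?thesis
        using True
        by (simp add: wedge_def of_fun_def c(2) scaleR_sum_right del: of_real_power power_Suc
            flip: scaleR_conv_of_real)
    next
      case False
      then have "\<beta> x = 0" using b(4,5) by blast
      then show ?thesis using False by (simp add: wedge_def of_fun_def W_def f_def)
    qed
  qed
  moreover have "(\<lambda>x. \<beta> x ^ (n + 1)) \<in> Cinf \<A>"
    by (simp only: mem_Collect_eq) (rule smooth_fun_power[OF oc open_UNIV b(1)])
  \<comment> \<open>In the Leibniz rule the first term vanishes, as \<open>T\<close> kills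
    functions; the second is \<open>T X\<close>, because the cutoff is 1 at \<open>p\<close> and
    \<open>\<sigma> 0 = 1\<close>.\<close>
  then have "T (wedge (of_fun (\<lambda>x. \<beta> x ^ (n + 1))) X) = T X"
    using leibniz[OF msections_of_fun[OF oc vb] X] on_fun
    by (simp add: \<sigma> b(2) fun_cong[OF of_fun_def])
  ultimately show ?thesis using sum[OF finite_index_sets] by simp
qed


section \<open>The product with the time axis\<close>

lemma timeless_apply [simp]: "timeless X (x, t) = X x"
  by (simp add: timeless_def)

lemma timeless_wedge: "timeless (wedge X Y) = wedge (timeless X) (timeless Y)"
  by (auto simp: wedge_def)

lemma timeless_of_fun: "timeless (of_fun f) = of_fun (timeless f)"
  by (auto simp: of_fun_def)

lemma timeless_of_sec: "timeless (of_sec s) = of_sec (timeless s)"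
  by (auto simp: of_sec_def)

lemma inv_into_time_chart:
  assumes "inj_on \<phi> U" "x \<in> U"
  shows "inv_into (U \<times> UNIV) (\<lambda>(x, t). (\<phi> x, t)) (\<phi> x, t) = (x, t)"
proof -
  have "inj_on (\<lambda>(x, t). (\<phi> x, t)) (U \<times> UNIV)"
    using assms(1) by (auto simp: inj_on_def)
  from inv_into_f_f[OF this, of "(x, t)"] show ?thesis using assms(2) by simp
qed

text \<open>Openness of an image is tested on boxes, on which a product chart acts factor by
  factor.\<close>

lemma open_charts_time:
  fixes \<A> :: "('m::topological_space, 'e::real_inner) atlas"
  assumes "open_charts \<A>"
  shows "open_charts (time_atlas \<A>)"
proof -
  have "inj_on (\<lambda>(x, t). (\<phi> x, t)) (U \<times> UNIV) \<and> open ((\<lambda>(x, t). (\<phi> x, t)) ` ((U \<times> UNIV) \<inter> W))"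
    if U: "(U, \<phi>) \<in> \<A>" and "open W" for U \<phi> and W :: "('m \<times> real) set"
  proof
    show "inj_on (\<lambda>(x, t). (\<phi> x, t)) (U \<times> UNIV)"
      using assms U by (auto simp: open_charts_def inj_on_def)
    show "open ((\<lambda>(x, t). (\<phi> x, t)) ` ((U \<times> UNIV) \<inter> W))"
    proof (rule Topological_Spaces.openI)
      fix z assume "z \<in> (\<lambda>(x, t). (\<phi> x, t)) ` ((U \<times> UNIV) \<inter> W)"
      then obtain x t where z: "z = (\<phi> x, t)" "x \<in> U" "(x, t) \<in> W" by auto
      obtain A B where AB: "open A" "open B" "(x, t) \<in> A \<times> B" "A \<times> B \<subseteq> W"
        using open_prod_elim[OF \<open>open W\<close> z(3)] by metis
      have "open (\<phi> ` (U \<inter> A) \<times> B)" "z \<in> \<phi> ` (U \<inter> A) \<times> B"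
        using open_charts_image[OF assms U AB(1)] AB z by (auto intro: open_Times)
      moreover have "\<phi> ` (U \<inter> A) \<times> B \<subseteq> (\<lambda>(x, t). (\<phi> x, t)) ` ((U \<times> UNIV) \<inter> W)"
        using AB(4) by force
      ultimately show "\<exists>T. open T \<and> z \<in> T \<and> T \<subseteq> (\<lambda>(x, t). (\<phi> x, t)) ` ((U \<times> UNIV) \<inter> W)"
        by blast
    qed
  qed
  then show ?thesis unfolding open_charts_def time_atlas_def by fastforce
qed

text \<open>On the image of a product chart, \<open>inv_into\<close> is the inverse of the chart of
  M paired with the identity of time; smoothness over the product can thus be checked in the
  coordinates (a, t).\<close>

lemma smooth_fun_timeI:
  fixes \<A> :: "('m::topological_space, 'e::real_inner) atlas"
  assumes oc: "open_charts \<A>" and "open W"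
    and C: "\<And>U \<phi> k. (U, \<phi>) \<in> \<A> \<Longrightarrow>
      Ck_on k (\<phi> ` (U \<inter> W) \<times> UNIV) (\<lambda>a. f (inv_into U \<phi> (fst a), snd a))"
  shows "smooth_fun (time_atlas \<A>) (W \<times> UNIV) f"
proof (rule smooth_funI)
  fix U' \<phi>' k assume "(U', \<phi>') \<in> time_atlas \<A>"
  then obtain U \<phi> where U: "(U, \<phi>) \<in> \<A>" "U' = U \<times> UNIV" "\<phi>' = (\<lambda>(x, t). (\<phi> x, t))"
    by (auto simp: time_atlas_def)
  have inj: "inj_on \<phi> U" using oc U(1) by (auto simp: open_charts_def)
  have eq: "\<phi>' ` (U' \<inter> W \<times> UNIV) = \<phi> ` (U \<inter> W) \<times> UNIV"
    unfolding U(2,3) by force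
  show "Ck_on k (\<phi>' ` (U' \<inter> W \<times> UNIV)) (\<lambda>a. f (inv_into U' \<phi>' a))"
    unfolding eq
  proof (rule Ck_on_cong[OF _ _ C[OF U(1)]])
    show "open (\<phi> ` (U \<inter> W) \<times> (UNIV :: real set))"
      by (intro open_Times open_UNIV open_charts_image[OF oc U(1) \<open>open W\<close>])
    fix a :: "'e \<times> real" assume "a \<in> \<phi> ` (U \<inter> W) \<times> UNIV"
    then obtain x t where "a = (\<phi> x, t)" "x \<in> U" by auto
    then show "f (inv_into U \<phi> (fst a), snd a) = f (inv_into U' \<phi>' a)"
      unfolding U(2,3) by (simp add: inv_into_time_chart[OF inj] inv_into_f_f[OF inj])
  qed
qed

lemma smooth_fun_timeless:
  assumes "open_charts \<A>" "open W" "smooth_fun \<A> W f"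
  shows "smooth_fun (time_atlas \<A>) (W \<times> UNIV) (timeless f)"
proof (rule smooth_fun_timeI[OF assms(1,2)])
  fix U \<phi> k assume U: "(U, \<phi>) \<in> \<A>"
  show "Ck_on k (\<phi> ` (U \<inter> W) \<times> UNIV) (\<lambda>a. timeless f (inv_into U \<phi> (fst a), snd a))"
    unfolding timeless_apply
    by (rule Ck_on_compose_linear[OF _ bounded_linear_fst _ smooth_funD[OF assms(3) U]])
      (auto intro: open_Times open_charts_image[OF assms(1) U assms(2)])
qed

lemma Cinf_timeless: "open_charts \<A> \<Longrightarrow> f \<in> Cinf \<A> \<Longrightarrow> timeless f \<in> Cinf (time_atlas \<A>)"
  using smooth_fun_timeless[of \<A> UNIV f] by simp

lemma Ck_on_exp: "Ck_on k UNIV (\<lambda>t. exp (c * t :: real))"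
proof (induction k)
  case (Suc k)
  show ?case
    by (rule Ck_on_SucI[where F = "\<lambda>t v. exp (c * t) * (c * v)"])
      (auto intro!: derivative_eq_intros Ck_on_mult Suc.IH Ck_on_const)
qed (auto intro!: continuous_intros)

lemma Cinf_time:
  assumes "open_charts \<A>"
  shows "(\<lambda>(x, t). exp (c * t)) \<in> Cinf (time_atlas \<A>)"
proof -
  have "smooth_fun (time_atlas \<A>) (UNIV \<times> UNIV) (\<lambda>(x, t). exp (c * t))"
  proof (rule smooth_fun_timeI[OF assms open_UNIV])
    fix U \<phi> k assume U: "(U, \<phi>) \<in> \<A>"
    have "open (\<phi> ` (U \<inter> UNIV) \<times> (UNIV :: real set))"
      by (intro open_Times open_UNIV open_charts_image[OF assms U])
    then show "Ck_on k (\<phi> ` (U \<inter> UNIV) \<times> UNIV) (\<lambda>a. case (inv_into U \<phi> (fst a), snd a) of (x, t) \<Rightarrow> exp (c * t))"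
      unfolding prod.case by (rule Ck_on_compose_linear[OF _ bounded_linear_snd _ Ck_on_exp]) auto
  qed
  then show ?thesis by simp
qed

lemma wedge_frame_time: "wedge_frame (\<lambda>i (x, t). e i x) I (x, t) = wedge_frame e I x"
  by (simp add: wedge_frame_def)

lemma msections_timeless:
  assumes "open_charts \<A>" "vector_bundle \<A> E" "X \<in> msections \<A> E k"
  shows "timeless X \<in> msections (time_atlas \<A>) (time_bundle E) k"
  unfolding msections_iff
proof (clarify)
  fix U' e' assume "(U', e') \<in> frames (time_bundle E)"
  then obtain U e where U: "(U, e) \<in> frames E" "U' = U \<times> UNIV" "e' = (\<lambda>i (x, t). e i x)"
    by (auto simp: time_bundle_def)
  have "X \<in> frame_span \<A> (rank E) U e k" using assms(3) U(1) unfolding msections_iff by blast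
  then obtain c where c: "\<And>I. I \<subseteq> {..<rank E} \<and> int (card I) = k \<Longrightarrow> smooth_fun \<A> U (c I)"
    "\<And>x. x \<in> U \<Longrightarrow> X x = (\<Sum>I | I \<subseteq> {..<rank E} \<and> int (card I) = k. c I x *\<^sub>R wedge_frame e I x)"
    by (rule frame_spanE) (rule that; simp)
  have r: "rank (time_bundle E) = rank E" by (simp add: time_bundle_def)
  show "timeless X \<in> frame_span (time_atlas \<A>) (rank (time_bundle E)) U' e' k"
    unfolding frame_span_def r U(2,3)
    by (intro CollectI exI[of _ "\<lambda>I. timeless (c I)"] conjI allI impI ballI
        smooth_fun_timeless[OF assms(1) frame_open[OF assms(2) U(1)] c(1)])
      (auto simp: c(2) wedge_frame_time)
qed

lemma sections_timeless:
  fixes \<A> :: "('m::topological_space, 'e::real_inner) atlas" and E :: "('m, 'v::real_vector) vbundle"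
  assumes "open_charts \<A>" "vector_bundle \<A> E" "s \<in> sections \<A> E"
  shows "timeless s \<in> sections (time_atlas \<A>) (time_bundle E)"
  unfolding sections_def
proof (intro CollectI conjI allI, goal_cases)
  case (1 z)
  show ?case using assms(3) by (cases z) (auto simp: sections_def time_bundle_def)
next
  case 2
  show ?case
  proof (clarify)
    fix U' e' assume "(U', e') \<in> frames (time_bundle E)"
    then obtain U e where U: "(U, e) \<in> frames E" "U' = U \<times> UNIV" "e' = (\<lambda>i (x, t). e i x)"
      by (auto simp: time_bundle_def)
    have r: "rank (time_bundle E) = rank E" by (simp add: time_bundle_def)
    have "\<exists>c :: nat \<Rightarrow> 'm \<Rightarrow> real. (\<forall>i<rank E. smooth_fun \<A> U (c i)) \<and>
        (\<forall>x\<in>U. s x = (\<Sum>i<rank E. c i x *\<^sub>R e i x))"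
      using assms(3) U(1) unfolding sections_def mem_Collect_eq by blast
    then obtain c where c: "\<forall>i<rank E. smooth_fun \<A> U (c i)"
      "\<forall>x\<in>U. s x = (\<Sum>i<rank E. c i x *\<^sub>R e i x)" by (elim exE conjE)
    show "\<exists>c. (\<forall>i<rank (time_bundle E). smooth_fun (time_atlas \<A>) U' (c i)) \<and>
        (\<forall>z\<in>U'. timeless s z = (\<Sum>i<rank (time_bundle E). c i z *\<^sub>R e' i z))"
      unfolding r U(2,3)
      by (intro exI[of _ "\<lambda>i. timeless (c i)"] conjI allI impI ballI
          smooth_fun_timeless[OF assms(1) frame_open[OF assms(2) U(1)] c(1)[rule_format]])
        (auto simp: c(2)[rule_format])
  qed
qed


section \<open>Schouten brackets\<close>

lemma schouten_bracket_scaleR_add: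
  assumes "schouten_bracket \<A> E \<rho> br S"
    and "X \<in> all_msections \<A> E" "Y \<in> all_msections \<A> E" "Z \<in> all_msections \<A> E"
  shows "S (\<lambda>x. a *\<^sub>R X x + b *\<^sub>R Y x) Z = (\<lambda>x. a *\<^sub>R S X Z x + b *\<^sub>R S Y Z x)"
    and "S Z (\<lambda>x. a *\<^sub>R X x + b *\<^sub>R Y x) = (\<lambda>x. a *\<^sub>R S Z X x + b *\<^sub>R S Z Y x)"
  using assms(1)[unfolded schouten_bracket_def, THEN conjunct1] assms(2-) by blast+

lemma schouten_bracket_degree:
  assumes "schouten_bracket \<A> E \<rho> br S" "X \<in> msections \<A> E k" "Y \<in> msections \<A> E l"
  shows "S X Y \<in> msections \<A> E (k + l - 1)"
  using assms(1)[unfolded schouten_bracket_def, THEN conjunct2, THEN conjunct1] assms(2-) by blast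

lemma schouten_bracket_sections:
  assumes "schouten_bracket \<A> E \<rho> br S" "X \<in> sections \<A> E" "Y \<in> sections \<A> E"
  shows "S (of_sec X) (of_sec Y) = of_sec (br X Y)"
  using assms(1)[unfolded schouten_bracket_def, THEN conjunct2, THEN conjunct2, THEN conjunct1]
    assms(2-) by blast

lemma schouten_bracket_section_fun:
  assumes "schouten_bracket \<A> E \<rho> br S" "X \<in> sections \<A> E" "f \<in> Cinf \<A>"
  shows "S (of_sec X) (of_fun f) = of_fun (anchor_act \<rho> X f)"
  using assms(1)[unfolded schouten_bracket_def, THEN conjunct2, THEN conjunct2, THEN conjunct2,
      THEN conjunct1] assms(2-) by blast

lemma schouten_bracket_antisym:
  assumes "schouten_bracket \<A> E \<rho> br S" "X \<in> msections \<A> E k" "Y \<in> msections \<A> E l"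
  shows "S X Y x = - ((- 1) powi ((k - 1) * (l - 1))) *\<^sub>R S Y X x"
  using assms(1)[unfolded schouten_bracket_def, THEN conjunct2, THEN conjunct2, THEN conjunct2,
      THEN conjunct2, THEN conjunct1, rule_format, OF assms(2,3)] by (rule fun_cong)

lemma schouten_bracket_leibniz:
  assumes "schouten_bracket \<A> E \<rho> br S"
    and "X \<in> msections \<A> E k" "Y \<in> msections \<A> E l" "Z \<in> msections \<A> E j"
  shows "S X (wedge Y Z) x = S X Y x * Z x + ((- 1) powi ((k - 1) * l)) *\<^sub>R (Y x * S X Z x)"
  using fun_cong[OF assms(1)[unfolded schouten_bracket_def, THEN conjunct2, THEN conjunct2,
      THEN conjunct2, THEN conjunct2, THEN conjunct2, rule_format, OF assms(2-)], of x]
  by (simp add: wedge_def)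

lemma contraction_scaleR_add:
  assumes "contraction \<A> E \<Phi> \<iota>" "X \<in> all_msections \<A> E" "Y \<in> all_msections \<A> E"
  shows "\<iota> (\<lambda>x. a *\<^sub>R X x + b *\<^sub>R Y x) = (\<lambda>x. a *\<^sub>R \<iota> X x + b *\<^sub>R \<iota> Y x)"
  using assms(1)[unfolded contraction_def, THEN conjunct1] assms(2-) by blast

lemma contraction_degree:
  assumes "contraction \<A> E \<Phi> \<iota>" "X \<in> msections \<A> E k"
  shows "\<iota> X \<in> msections \<A> E (k - 1)"
  using assms(1)[unfolded contraction_def, THEN conjunct2, THEN conjunct1] assms(2-) by blast

lemma contraction_leibniz:
  assumes "contraction \<A> E \<Phi> \<iota>" "X \<in> msections \<A> E k" "Y \<in> msections \<A> E l"
  shows "\<iota> (wedge X Y) x = \<iota> X x * Y x + ((- 1) powi k) *\<^sub>R (X x * \<iota> Y x)"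
  using fun_cong[OF assms(1)[unfolded contraction_def, THEN conjunct2, THEN conjunct2,
      THEN conjunct1, rule_format, OF assms(2-)], of x]
  by (simp add: wedge_def)

lemma contraction_section:
  assumes "contraction \<A> E \<Phi> \<iota>" "X \<in> sections \<A> E"
  shows "\<iota> (of_sec X) = of_fun (\<lambda>x. \<Phi> x (X x))"
  using assms(1)[unfolded contraction_def, THEN conjunct2, THEN conjunct2, THEN conjunct2,
      THEN conjunct1] assms(2) by blast

lemma contraction_fun:
  assumes "contraction \<A> E \<Phi> \<iota>" "f \<in> Cinf \<A>"
  shows "\<iota> (of_fun f) = (\<lambda>x. 0)"
  using assms(1)[unfolded contraction_def, THEN conjunct2, THEN conjunct2, THEN conjunct2,
      THEN conjunct2] assms(2) by blast

lemma minus_one_powi: "(- 1 :: real) powi n = (if even n then 1 else - 1)"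
  by (simp add: power_int_minus_left)

text \<open>The product rule gives D 1 = D (1 * 1) = 2 D 1. It makes the M-part of the extended
  anchor vanish on functions of time alone.\<close>

lemma tangent_vector_const:
  assumes "open_charts \<A>" "tangent_vector \<A> x D"
  shows "D (\<lambda>z. c) = 0"
proof -
  have one: "(\<lambda>z. 1) \<in> Cinf \<A>" by (simp add: smooth_fun_const[OF assms(1)])
  have "D (\<lambda>z. 1 * 1) = D (\<lambda>z. 1) * 1 + 1 * D (\<lambda>z. 1)"
    by (rule assms(2)[unfolded tangent_vector_def, THEN conjunct2, rule_format, OF one one])
  moreover have "D (\<lambda>z. c * 1 + 0 * 1) = c * D (\<lambda>z. 1) + 0 * D (\<lambda>z. 1)"
    by (rule assms(2)[unfolded tangent_vector_def, THEN conjunct1, rule_format, OF one one])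
  ultimately show ?thesis by simp
qed


section \<open>The extended bracket on time-independent multisections\<close>

context
  fixes \<A> :: "('m::{t2_space, second_countable_topology}, 'e::real_inner) atlas"
    and E :: "('m, 'v::real_vector) vbundle"
    and \<rho> :: "('m, 'v) anchor"
    and br :: "('m \<Rightarrow> 'v) \<Rightarrow> ('m \<Rightarrow> 'v) \<Rightarrow> 'm \<Rightarrow> 'v"
    and S :: "('m \<Rightarrow> 'v ext) \<Rightarrow> ('m \<Rightarrow> 'v ext) \<Rightarrow> 'm \<Rightarrow> 'v ext"
    and \<Phi> :: "'m \<Rightarrow> 'v \<Rightarrow> real"
    and \<iota> :: "('m \<Rightarrow> 'v ext) \<Rightarrow> 'm \<Rightarrow> 'v ext"
    and brh :: "('m \<times> real \<Rightarrow> 'v) \<Rightarrow> ('m \<times> real \<Rightarrow> 'v) \<Rightarrow> 'm \<times> real \<Rightarrow> 'v"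
    and Sh :: "('m \<times> real \<Rightarrow> 'v ext) \<Rightarrow> ('m \<times> real \<Rightarrow> 'v ext) \<Rightarrow> 'm \<times> real \<Rightarrow> 'v ext"
  assumes man: "smooth_manifold \<A>"
    and la: "lie_algebroid \<A> E \<rho> br"
    and S: "schouten_bracket \<A> E \<rho> br S"
    and \<iota>: "contraction \<A> E \<Phi> \<iota>"
    and ext: "extended_lie_algebroid \<A> E \<rho> br \<Phi> brh"
    and Sh: "schouten_bracket (time_atlas \<A>) (time_bundle E) (time_anchor \<rho> \<Phi>) brh Sh"
begin

lemma open_charts_base: "open_charts \<A>"
  by (rule open_charts_manifold[OF man])

lemma open_charts_ext: "open_charts (time_atlas \<A>)"
  by (rule open_charts_time[OF open_charts_base])

lemma vector_bundle_base: "vector_bundle \<A> E"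
  using la by (simp add: lie_algebroid_def)

lemma vector_bundle_ext: "vector_bundle (time_atlas \<A>) (time_bundle E)"
  using ext by (simp add: extended_lie_algebroid_def lie_algebroid_def)

lemmas timeless_msections = msections_timeless[OF open_charts_base vector_bundle_base]

lemma anchor_tangent:
  assumes "s \<in> sections \<A> E"
  shows "tangent_vector \<A> x (\<rho> x (s x))"
proof -
  have "s x \<in> fibre E x" using assms by (simp add: sections_def)
  then show ?thesis
    using la[unfolded lie_algebroid_def is_anchor_def, THEN conjunct2, THEN conjunct1, THEN conjunct1] by blast
qed

lemma Sh_section_timeless_fun:
  assumes "s \<in> sections \<A> E" "f \<in> Cinf \<A>"
  shows "Sh (timeless (of_sec s)) (timeless (of_fun f)) = timeless (S (of_sec s) (of_fun f))"
proof -
  have "anchor_act (time_anchor \<rho> \<Phi>) (timeless s) (timeless f) = timeless (anchor_act \<rho> s f)"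
    by (auto simp: anchor_act_def time_anchor_def)
  then show ?thesis
    using schouten_bracket_section_fun[OF Sh sections_timeless[OF open_charts_base vector_bundle_base assms(1)] Cinf_timeless[OF open_charts_base assms(2)]]
    by (simp add: timeless_of_sec timeless_of_fun schouten_bracket_section_fun[OF S assms])
qed

lemma Sh_timeless_sections:
  assumes "s \<in> sections \<A> E" "s' \<in> sections \<A> E"
  shows "Sh (timeless (of_sec s)) (timeless (of_sec s')) = timeless (S (of_sec s) (of_sec s'))"
  using schouten_bracket_sections[OF Sh sections_timeless[OF open_charts_base vector_bundle_base assms(1)] sections_timeless[OF open_charts_base vector_bundle_base assms(2)]]
    ext assms
  by (simp add: timeless_of_sec schouten_bracket_sections[OF S assms] extended_lie_algebroid_def)

text \<open>\<open>timeless\<close> preserves degrees, so exchanging the arguments produces the same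
  sign in both brackets.\<close>

lemma Sh_timeless_flip:
  assumes "X \<in> msections \<A> E k" "Y \<in> msections \<A> E l"
    and "Sh (timeless X) (timeless Y) = timeless (S X Y)"
  shows "Sh (timeless Y) (timeless X) = timeless (S Y X)"
proof
  fix z :: "'m \<times> real"
  show "Sh (timeless Y) (timeless X) z = timeless (S Y X) z"
    using schouten_bracket_antisym[OF Sh timeless_msections[OF assms(2)] timeless_msections[OF assms(1)], of z]
      schouten_bracket_antisym[OF S assms(2,1), of "fst z"] assms(3)
    by (cases z) simp
qed

text \<open>At a fixed point (p, t) the difference of the two sides is, as a function of
  \<open>Y\<close>, a derivation at \<open>p\<close>; it vanishes as soon as it does so on functions
  and sections over M.\<close>

lemma Sh_timeless_extend:
  assumes X: "X \<in> msections \<A> E j"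
    and on_fun: "\<And>f. f \<in> Cinf \<A> \<Longrightarrow> Sh (timeless X) (timeless (of_fun f)) = timeless (S X (of_fun f))"
    and on_sec: "\<And>s. s \<in> sections \<A> E \<Longrightarrow> Sh (timeless X) (timeless (of_sec s)) = timeless (S X (of_sec s))"
    and Y: "Y \<in> msections \<A> E l"
  shows "Sh (timeless X) (timeless Y) = timeless (S X Y)"
proof
  fix z :: "'m \<times> real"
  obtain p t where z: "z = (p, t)" by (cases z)
  define T where "T = (\<lambda>Y. Sh (timeless X) (timeless Y) (p, t) - S X Y p)"
  note all = msections_all[OF open_charts_base vector_bundle_base] msections_all[OF open_charts_ext vector_bundle_ext]
  have "T Y = 0"
  \<comment> \<open>The sign \<open>\<sigma>\<close> is that of the Leibniz rule for a bracket whose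
    first argument has degree \<open>j\<close>.\<close>
  proof (rule point_derivation_eq_0[OF man vector_bundle_base _ _ _ _ _ Y, where p = p and \<sigma> = "\<lambda>k. (- 1) powi ((j - 1) * k)"])
    fix k X' Y' and a b :: real
    assume XY: "X' \<in> msections \<A> E k" "Y' \<in> msections \<A> E k"
    have "timeless (\<lambda>x. a *\<^sub>R X' x + b *\<^sub>R Y' x) = (\<lambda>z. a *\<^sub>R timeless X' z + b *\<^sub>R timeless Y' z)"
      by auto
    then show "T (\<lambda>x. a *\<^sub>R X' x + b *\<^sub>R Y' x) = a *\<^sub>R T X' + b *\<^sub>R T Y'"
      unfolding T_def
      using schouten_bracket_scaleR_add(2)[OF S all(1)[OF XY(1)] all(1)[OF XY(2)] all(1)[OF X], of a b]
        schouten_bracket_scaleR_add(2)[OF Sh all(2)[OF timeless_msections[OF XY(1)]]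
          all(2)[OF timeless_msections[OF XY(2)]] all(2)[OF timeless_msections[OF X]], of a b]
      by (simp add: algebra_simps)
  next
    fix k l X' Y'
    assume XY: "X' \<in> msections \<A> E k" "Y' \<in> msections \<A> E l"
    show "T (wedge X' Y') = T X' * Y' p + ((- 1) powi ((j - 1) * k)) *\<^sub>R (X' p * T Y')"
      unfolding T_def timeless_wedge schouten_bracket_leibniz[OF S X XY]
        schouten_bracket_leibniz[OF Sh timeless_msections[OF X] timeless_msections[OF XY(1)] timeless_msections[OF XY(2)]]
      by (simp add: algebra_simps)
  qed (simp_all add: T_def on_fun on_sec)
  then show "Sh (timeless X) (timeless Y) z = timeless (S X Y) z"
    by (simp add: z T_def)
qed

lemma Sh_timeless:
  assumes X: "X \<in> msections \<A> E k" and Y: "Y \<in> msections \<A> E l"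
  shows "Sh (timeless X) (timeless Y) = timeless (S X Y)"
proof -
  note of_fun = msections_of_fun[OF open_charts_base vector_bundle_base] and of_sec = msections_of_sec[OF open_charts_base vector_bundle_base]
  have fun_left: "Sh (timeless (of_fun f)) (timeless Z) = timeless (S (of_fun f) Z)"
    if f: "f \<in> Cinf \<A>" and Z: "Z \<in> msections \<A> E j" for f Z j
  proof (rule Sh_timeless_extend[OF of_fun[OF f] _ _ Z])
    fix g assume g: "g \<in> Cinf \<A>"
    \<comment> \<open>Two functions have a bracket of degree -1, which is 0 on M as well as on the
      product.\<close>
    have "S (of_fun f) (of_fun g) = (\<lambda>x. 0)"
      by (rule msections_trivial[OF open_charts_base vector_bundle_base schouten_bracket_degree[OF S of_fun[OF f] of_fun[OF g]]]) simp
    moreover have "Sh (timeless (of_fun f)) (timeless (of_fun g)) = (\<lambda>x. 0)"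
      by (rule msections_trivial[OF open_charts_ext vector_bundle_ext schouten_bracket_degree[OF Sh timeless_msections[OF of_fun[OF f]]
              timeless_msections[OF of_fun[OF g]]]]) simp
    ultimately show "Sh (timeless (of_fun f)) (timeless (of_fun g)) = timeless (S (of_fun f) (of_fun g))"
      by auto
  next
    fix s assume "s \<in> sections \<A> E"
    then show "Sh (timeless (of_fun f)) (timeless (of_sec s)) = timeless (S (of_fun f) (of_sec s))"
      by (intro Sh_timeless_flip[OF of_sec of_fun Sh_section_timeless_fun] f)
  qed
  have sec_left: "Sh (timeless (of_sec s)) (timeless Z) = timeless (S (of_sec s) Z)"
    if s: "s \<in> sections \<A> E" and Z: "Z \<in> msections \<A> E j" for s Z j
    by (rule Sh_timeless_extend[OF of_sec[OF s] Sh_section_timeless_fun[OF s] Sh_timeless_sections[OF s] Z])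
  show ?thesis
  \<comment> \<open>The values on generators which this requires are \<open>fun_left\<close> and
    \<open>sec_left\<close> at Z = X, with the arguments exchanged.\<close>
  proof (rule Sh_timeless_extend[OF X _ _ Y])
    fix f assume f: "f \<in> Cinf \<A>"
    show "Sh (timeless X) (timeless (of_fun f)) = timeless (S X (of_fun f))"
      by (rule Sh_timeless_flip[OF of_fun[OF f] X fun_left[OF f X]])
  next
    fix s assume s: "s \<in> sections \<A> E"
    show "Sh (timeless X) (timeless (of_sec s)) = timeless (S X (of_sec s))"
      by (rule Sh_timeless_flip[OF of_sec[OF s] X sec_left[OF s X]])
  qed
qed

text \<open>The rate \<open>c\<close> is left free because the two arguments of the bracket carry
  different weights.\<close>

abbreviation expt :: "real \<Rightarrow> 'm \<times> real \<Rightarrow> 'v ext" where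
  "expt c \<equiv> of_fun (\<lambda>(x, t). exp (c * t))"

lemma expt_msections: "expt c \<in> msections (time_atlas \<A>) (time_bundle E) 0"
  by (rule msections_of_fun[OF open_charts_ext vector_bundle_ext Cinf_time[OF open_charts_base]])

lemma expt_mult: "expt c (p, t) * a = exp (c * t) *\<^sub>R a"
  by (simp add: of_fun_def scaleR_conv_of_real)

text \<open>\<open>\<lbrakk>f(t), X\<rbrakk> = - f'(t) i\<^sub>\<Phi> X\<close>: both sides are derivations of degree \<open>-1\<close> in \<open>X\<close>.\<close>

lemma Sh_expt_timeless:
  assumes X: "X \<in> msections \<A> E k"
  shows "Sh (expt c) (timeless X) (p, t) = - (c * exp (c * t)) *\<^sub>R \<iota> X p"
proof -
  define T where "T = (\<lambda>X. Sh (expt c) (timeless X) (p, t) + (c * exp (c * t)) *\<^sub>R \<iota> X p)"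
  note all = msections_all[OF open_charts_base vector_bundle_base] msections_all[OF open_charts_ext vector_bundle_ext]
  have "T X = 0"
  \<comment> \<open>\<open>expt c\<close> has shifted degree -1, so its bracket satisfies the
    Leibniz rule with sign (-1)^(-k) = (-1)^k, the same as for the contraction.\<close>
  proof (rule point_derivation_eq_0[OF man vector_bundle_base _ _ _ _ _ X, where p = p and \<sigma> = "\<lambda>k. (- 1) powi k"])
    fix k X' Y' and a b :: real
    assume XY: "X' \<in> msections \<A> E k" "Y' \<in> msections \<A> E k"
    have "timeless (\<lambda>x. a *\<^sub>R X' x + b *\<^sub>R Y' x) = (\<lambda>z. a *\<^sub>R timeless X' z + b *\<^sub>R timeless Y' z)"
      by auto
    then show "T (\<lambda>x. a *\<^sub>R X' x + b *\<^sub>R Y' x) = a *\<^sub>R T X' + b *\<^sub>R T Y'"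
      unfolding T_def
      using contraction_scaleR_add[OF \<iota> all(1)[OF XY(1)] all(1)[OF XY(2)], of a b]
        schouten_bracket_scaleR_add(2)[OF Sh all(2)[OF timeless_msections[OF XY(1)]]
          all(2)[OF timeless_msections[OF XY(2)]] all(2)[OF expt_msections[of c]], of a b]
      by (simp add: algebra_simps)
  next
    fix k l X' Y'
    assume XY: "X' \<in> msections \<A> E k" "Y' \<in> msections \<A> E l"
    show "T (wedge X' Y') = T X' * Y' p + ((- 1) powi k) *\<^sub>R (X' p * T Y')"
      unfolding T_def timeless_wedge contraction_leibniz[OF \<iota> XY]
        schouten_bracket_leibniz[OF Sh expt_msections timeless_msections[OF XY(1)] timeless_msections[OF XY(2)]]
      by (simp add: algebra_simps minus_one_powi)
  next
    fix f assume f: "f \<in> Cinf \<A>"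
    have "Sh (expt c) (timeless (of_fun f)) = (\<lambda>x. 0)"
      by (rule msections_trivial[OF open_charts_ext vector_bundle_ext schouten_bracket_degree[OF Sh expt_msections
              timeless_msections[OF msections_of_fun[OF open_charts_base vector_bundle_base f]]]]) simp
    then show "T (of_fun f) = 0" by (simp add: T_def contraction_fun[OF \<iota> f])
  next
    fix s assume s: "s \<in> sections \<A> E"
    have "((\<lambda>t. exp (c * t)) has_real_derivative c * exp (c * t)) (at t)"
      by (auto intro!: derivative_eq_intros)
    then have "anchor_act (time_anchor \<rho> \<Phi>) (timeless s) (\<lambda>(x, t). exp (c * t)) (p, t)
        = \<Phi> p (s p) * (c * exp (c * t))"
      using tangent_vector_const[OF open_charts_base anchor_tangent[OF s]]
      by (simp add: anchor_act_def time_anchor_def DERIV_imp_deriv)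
    then have "Sh (timeless (of_sec s)) (expt c) (p, t) = of_real (\<Phi> p (s p) * (c * exp (c * t)))"
      unfolding timeless_of_sec
        schouten_bracket_section_fun[OF Sh sections_timeless[OF open_charts_base vector_bundle_base s] Cinf_time[OF open_charts_base]]
      by (simp add: of_fun_def)
    \<comment> \<open>For shifted degrees -1 and 0 the bracket is plainly antisymmetric, which
      supplies the minus sign that cancels the contraction term.\<close>
    then show "T (of_sec s) = 0"
      using schouten_bracket_antisym[OF Sh expt_msections timeless_msections[OF msections_of_sec[OF open_charts_base vector_bundle_base s]],
          of c "(p, t)"]
      by (simp add: T_def contraction_section[OF \<iota> s] fun_cong[OF of_fun_def[of "\<lambda>x. \<Phi> x (s x)"]]
          scaleR_conv_of_real ac_simps del: of_real_mult flip: of_real_mult)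
  qed simp
  then show ?thesis by (simp add: T_def eq_neg_iff_add_eq_0)
qed

text \<open>This presents the rescaling as a product with an element of degree 0, the form to which
  the Leibniz rule applies. For degrees outside the range of the sum both sides vanish with
  \<open>X\<close>.\<close>

lemma Utilde_msections:
  assumes X: "X \<in> msections \<A> E k"
  shows "Utilde E X = wedge (expt (- of_int (k - 1))) (timeless X)"
proof
  fix z :: "'m \<times> real"
  obtain p t where z: "z = (p, t)" by (cases z)
  have "Utilde E X z = (\<Sum>j\<le>rank E. if int j = k then exp (- of_int (k - 1) * t) *\<^sub>R X p else 0)"
    unfolding Utilde_def z prod.case timeless_apply msections_part[OF open_charts_base vector_bundle_base X] by (intro sum.cong) auto
  also have "\<dots> = exp (- of_int (k - 1) * t) *\<^sub>R X p"
  proof (cases "k < 0 \<or> int (rank E) < k")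
    case True
    then have "X p = 0" using msections_trivial[OF open_charts_base vector_bundle_base X] by simp
    then show ?thesis by (simp cong: if_cong)
  next
    case False
    then obtain n where n: "k = int n" "n \<le> rank E" using nonneg_int_cases[of k] by auto
    then show ?thesis by simp
  qed
  finally show "Utilde E X z = wedge (expt (- of_int (k - 1))) (timeless X) z"
    by (simp add: z wedge_def expt_mult)
qed

text \<open>The factor \<open>expt b\<close> is split off by the Leibniz rule; to reach
  \<open>expt a\<close> in the first argument, the arguments are exchanged, the rule is applied, and
  they are exchanged back. No term with both derivatives arises, since the bracket of two functions
  is 0. The rates a = -x and b = -y give the coefficients of the Schouten-Jacobi bracket.\<close>

lemma Sh_expt_wedge:
  assumes X: "X \<in> msections \<A> E k" and Y: "Y \<in> msections \<A> E l"
  shows "Sh (wedge (expt a) (timeless X)) (wedge (expt b) (timeless Y)) (p, t)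
    = exp ((a + b) * t) *\<^sub>R (S X Y p - a *\<^sub>R (X p * \<iota> Y p) + ((- 1) powi (k - 1) * b) *\<^sub>R (\<iota> X p * Y p))"
proof -
  note Xh = timeless_msections[OF X] and Yh = timeless_msections[OF Y]
  have fX: "wedge (expt a) (timeless X) \<in> msections (time_atlas \<A>) (time_bundle E) k"
    using msections_wedge[OF open_charts_ext vector_bundle_ext expt_msections Xh] by simp
  let ?\<alpha> = "exp (a * t)" and ?\<beta> = "exp (b * t)"
  have ff: "Sh (expt b) (expt a) = (\<lambda>x. 0)"
    by (rule msections_trivial[OF open_charts_ext vector_bundle_ext schouten_bracket_degree[OF Sh expt_msections expt_msections]]) simp
  have 1: "Sh (expt b) (wedge (expt a) (timeless X)) (p, t) = - (?\<alpha> * (b * ?\<beta>)) *\<^sub>R \<iota> X p"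
    using schouten_bracket_leibniz[OF Sh expt_msections expt_msections Xh, of b a "(p, t)"]
    by (simp add: ff Sh_expt_timeless[OF X] expt_mult)
  have 2: "Sh (wedge (expt a) (timeless X)) (expt b) (p, t) = ((- 1) powi (k - 1) * (?\<alpha> * (b * ?\<beta>))) *\<^sub>R \<iota> X p"
    using schouten_bracket_antisym[OF Sh fX expt_msections, of b "(p, t)"]
    by (simp add: 1 minus_one_powi)
  have 3: "Sh (timeless Y) (expt a) (p, t) = ((- 1) powi (l - 1) * (a * ?\<alpha>)) *\<^sub>R \<iota> Y p"
    using schouten_bracket_antisym[OF Sh Yh expt_msections, of a "(p, t)"]
    by (simp add: Sh_expt_timeless[OF Y] minus_one_powi)
  have 4: "Sh (timeless Y) (wedge (expt a) (timeless X)) (p, t)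
      = ((- 1) powi (l - 1) * (a * ?\<alpha>)) *\<^sub>R (\<iota> Y p * X p) + ?\<alpha> *\<^sub>R S Y X p"
    using schouten_bracket_leibniz[OF Sh Yh expt_msections Xh, of a "(p, t)"]
    by (simp add: 3 Sh_timeless[OF Y X] expt_mult)
  have 5: "\<iota> Y p * X p = ((- 1) powi ((l - 1) * k)) *\<^sub>R (X p * \<iota> Y p)"
    by (rule msections_commute[OF open_charts_base vector_bundle_base contraction_degree[OF \<iota> Y] X])
  have 6: "S X Y p = - ((- 1) powi ((k - 1) * (l - 1))) *\<^sub>R S Y X p"
    by (rule schouten_bracket_antisym[OF S X Y])
  \<comment> \<open>In the contraction term the sign exponents (l-1) from \<open>4\<close>, (l-1)k
    from \<open>5\<close> and (k-1)(l-1) from antisymmetry add up to 2k(l-1), so only the minus sign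
    of antisymmetry remains.\<close>
  have 7: "Sh (wedge (expt a) (timeless X)) (timeless Y) (p, t)
      = ?\<alpha> *\<^sub>R S X Y p - (a * ?\<alpha>) *\<^sub>R (X p * \<iota> Y p)"
    using schouten_bracket_antisym[OF Sh fX Yh, of "(p, t)"]
    by (cases "even k"; cases "even l"; simp add: 4 5 6 minus_one_powi scaleR_add_right)
  have "Sh (wedge (expt a) (timeless X)) (wedge (expt b) (timeless Y)) (p, t)
      = Sh (wedge (expt a) (timeless X)) (expt b) (p, t) * Y p
        + ?\<beta> *\<^sub>R Sh (wedge (expt a) (timeless X)) (timeless Y) (p, t)"
    using schouten_bracket_leibniz[OF Sh fX expt_msections Yh, of b "(p, t)"]
    by (simp add: expt_mult)
  also have "\<dots> = exp ((a + b) * t) *\<^sub>R (S X Y p - a *\<^sub>R (X p * \<iota> Y p) + ((- 1) powi (k - 1) * b) *\<^sub>R (\<iota> X p * Y p))"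
    unfolding 2 7 by (simp add: exp_add algebra_simps)
  finally show ?thesis .
qed

text \<open>For homogeneous arguments only one pair of components is nonzero, and every term of the
  formula vanishes when one argument does.\<close>

lemma schouten_jacobi_msections:
  assumes X: "X \<in> msections \<A> E k" and Y: "Y \<in> msections \<A> E l"
  shows "schouten_jacobi E S \<iota> X Y = (\<lambda>p. S X Y p + of_int (k - 1) *\<^sub>R wedge X (\<iota> Y) p
           - ((- 1) powi (k - 1) * of_int (l - 1)) *\<^sub>R wedge (\<iota> X) Y p)" (is "_ = ?Z X Y k l")
proof
  fix p
  note all = msections_all[OF open_charts_base vector_bundle_base X] msections_all[OF open_charts_base vector_bundle_base Y]
  have S0: "S (\<lambda>x. 0) Z = (\<lambda>x. 0)" "S Z (\<lambda>x. 0) = (\<lambda>x. 0)" if "Z \<in> all_msections \<A> E" for Z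
    using schouten_bracket_scaleR_add[OF S that that that, of 0 0] by simp_all
  have \<iota>0: "\<iota> (\<lambda>x. 0) = (\<lambda>x. 0)"
    using contraction_scaleR_add[OF \<iota> all(1) all(1), of 0 0] by simp
  have all0: "(\<lambda>x. 0) \<in> all_msections \<A> E"
    using msections_all[OF open_charts_base vector_bundle_base msections_zero[OF open_charts_base vector_bundle_base]] .
  have Z0: "?Z (\<lambda>x. 0) Y i j p = 0" "?Z X (\<lambda>x. 0) i j p = 0" "?Z (\<lambda>x. 0) (\<lambda>x. 0) i j p = 0" for i j
    by (simp_all add: S0 all all0 \<iota>0 wedge_def)
  have "schouten_jacobi E S \<iota> X Y p
      = (\<Sum>i\<le>rank E. \<Sum>j\<le>rank E. ?Z (part i X) (part j Y) (int i) (int j) p)"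
    by (simp add: schouten_jacobi_def)
  also have "\<dots> = (\<Sum>i\<le>rank E. if int i = k then (\<Sum>j\<le>rank E. if int j = l then ?Z X Y k l p else 0) else 0)"
    unfolding msections_part[OF open_charts_base vector_bundle_base X] msections_part[OF open_charts_base vector_bundle_base Y]
    by (intro sum.cong refl) (auto simp: S0 all all0 \<iota>0 wedge_def intro!: sum.neutral sum.cong)
  also have "\<dots> = ?Z X Y k l p"
  proof (cases "(k < 0 \<or> int (rank E) < k) \<or> (l < 0 \<or> int (rank E) < l)")
    \<comment> \<open>The sum then contains no index matching both degrees; the formula agrees with
      it because \<open>X\<close> or \<open>Y\<close> is 0.\<close>
    case True
    then have "?Z X Y k l p = 0"
      using msections_trivial[OF open_charts_base vector_bundle_base X] msections_trivial[OF open_charts_base vector_bundle_base Y] Z0 by metis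
    then show ?thesis by (simp del: of_int_diff cong: if_cong)
  next
    case False
    then obtain m n where "k = int m" "l = int n"
      by (metis not_less zero_le_imp_eq_int)
    with False show ?thesis by simp
  qed
  finally show "schouten_jacobi E S \<iota> X Y p = ?Z X Y k l p" .
qed

text \<open>All three terms on the right have degree k + l - 1, hence shifted degree (k-1) + (l-1).
  The factor common to them in \<open>Sh_expt_wedge\<close> is therefore the weight of their
  sum.\<close>

lemma Sh_Utilde:
  assumes X: "X \<in> msections \<A> E k" and Y: "Y \<in> msections \<A> E l"
  shows "Sh (Utilde E X) (Utilde E Y) = Utilde E (\<lambda>p. S X Y p + of_int (k - 1) *\<^sub>R wedge X (\<iota> Y) p
           - ((- 1) powi (k - 1) * of_int (l - 1)) *\<^sub>R wedge (\<iota> X) Y p)" (is "_ = Utilde E ?Z")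
proof
  fix z :: "'m \<times> real"
  obtain p t where z: "z = (p, t)" by (cases z)
  have "wedge X (\<iota> Y) \<in> msections \<A> E (k + l - 1)" "wedge (\<iota> X) Y \<in> msections \<A> E (k + l - 1)"
    using msections_wedge[OF open_charts_base vector_bundle_base X contraction_degree[OF \<iota> Y]]
      msections_wedge[OF open_charts_base vector_bundle_base contraction_degree[OF \<iota> X] Y] by (simp_all add: algebra_simps)
  then have "(\<lambda>p. (S X Y p + of_int (k - 1) *\<^sub>R wedge X (\<iota> Y) p)
      + (- ((- 1) powi (k - 1) * of_int (l - 1))) *\<^sub>R wedge (\<iota> X) Y p) \<in> msections \<A> E (k + l - 1)"
    by (intro msections_add[OF open_charts_base vector_bundle_base] msections_scaleR[OF open_charts_base vector_bundle_base] schouten_bracket_degree[OF S X Y])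
  then have Z: "?Z \<in> msections \<A> E (k + l - 1)" by simp
  show "Sh (Utilde E X) (Utilde E Y) z = Utilde E ?Z z"
    unfolding Utilde_msections[OF X] Utilde_msections[OF Y] Utilde_msections[OF Z] z Sh_expt_wedge[OF X Y]
    by (simp add: wedge_def of_fun_def algebra_simps flip: scaleR_conv_of_real)
qed

end

theorem theorem3:
  fixes \<A> :: "('m::{t2_space, second_countable_topology}, 'e::real_inner) atlas"
    and E :: "('m, 'v::real_vector) vbundle"
    and \<rho> :: "('m, 'v) anchor"
    and br :: "('m \<Rightarrow> 'v) \<Rightarrow> ('m \<Rightarrow> 'v) \<Rightarrow> 'm \<Rightarrow> 'v"
    and S :: "('m \<Rightarrow> 'v ext) \<Rightarrow> ('m \<Rightarrow> 'v ext) \<Rightarrow> 'm \<Rightarrow> 'v ext"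
    and \<Phi> :: "'m \<Rightarrow> 'v \<Rightarrow> real"
    and \<iota> :: "('m \<Rightarrow> 'v ext) \<Rightarrow> 'm \<Rightarrow> 'v ext"
    and brh :: "('m \<times> real \<Rightarrow> 'v) \<Rightarrow> ('m \<times> real \<Rightarrow> 'v) \<Rightarrow> 'm \<times> real \<Rightarrow> 'v"
    and Sh :: "('m \<times> real \<Rightarrow> 'v ext) \<Rightarrow> ('m \<times> real \<Rightarrow> 'v ext) \<Rightarrow> 'm \<times> real \<Rightarrow> 'v ext"
    and X Y :: "'m \<Rightarrow> 'v ext"
    and k l x y :: int
  assumes "smooth_manifold \<A>"
    and "lie_algebroid \<A> E \<rho> br"
    and "schouten_bracket \<A> E \<rho> br S"
    and "cocycle \<A> E \<rho> br \<Phi>"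
    and "contraction \<A> E \<Phi> \<iota>"
    and "extended_lie_algebroid \<A> E \<rho> br \<Phi> brh"
    and "schouten_bracket (time_atlas \<A>) (time_bundle E) (time_anchor \<rho> \<Phi>) brh Sh"
    and "X \<in> msections \<A> E k" and "x = k - 1"
    and "Y \<in> msections \<A> E l" and "y = l - 1"
  shows "Sh (Utilde E X) (Utilde E Y) =
           Utilde E (\<lambda>p. S X Y p + of_int x *\<^sub>R wedge X (\<iota> Y) p
                         - ((- 1) powi x * of_int y) *\<^sub>R wedge (\<iota> X) Y p) \<and>
         Utilde E (\<lambda>p. S X Y p + of_int x *\<^sub>R wedge X (\<iota> Y) p
                       - ((- 1) powi x * of_int y) *\<^sub>R wedge (\<iota> X) Y p) =
           Utilde E (schouten_jacobi E S \<iota> X Y)"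
  using assms Sh_Utilde[OF assms(1,2,3,5,6,7,8,10)] schouten_jacobi_msections[OF assms(1,2,3,5,6,7,8,10)]
  by simp

end
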